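(* Let $s\ge1$ be an integer and let $f$ be a regular function in $D_1$ having there exactly $s$ zeroes (counted with multiplicity), and being $(s,p)$-valent in $D_1$. Assume that $Z\subset D_R$ with $R<1$, and that $c_s(Z)=c>0$. Then on each $D_{R'}$ with $0\le R'<1$ the function $f$ satisfies $$\max_{D_{R'}}|f(x)|\ \le\ \sigma(R,R')^p\Big(\frac{6e}{c}\Big)^s\max_Z|f(x)|,$$ where $$\sigma(R,R')=\Big[\frac{(1+R)(1+R')}{(1-R)(1-R')}\Big]^2.$$
   Context: $D_1=\{|x|<1\}\subset\mathbb{C}$ and, for $0\le R<1$, $D_R=\{|x|\le R\}$; "regular" means holomorphic. A function $f$ regular in a domain $\Omega\subset\mathbb{C}$ is called $(s,p)$-valent in $\Omega$ if for any complex polynomial $P(x)$ of degree at most $s$ the number of solutions of the equation $f(x)=P(x)$ in $\Omega$ does not exceed $p$. For $Z\subset\mathbb{C}$ and an integer $d\ge1$, $c_d(Z)$ is the minimal (infimum of the) sum of the radii of $d$ disks in $\mathbb{C}$ covering $Z$. A maximum over a set which need not be compact is read as a supremum. *)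

theory Defs
  imports "HOL-Complex_Analysis.Complex_Analysis" "HOL-Computational_Algebra.Polynomial"
begin

(* Solutions are counted as distinct points. On an open connected set this is equivalent to counting
   them with multiplicity, because a small perturbation of the constant term of P splits a multiple
   solution into simple ones. Finiteness is explicit since card is 0 on infinite sets; in particular
   a polynomial of degree at most s is not (s,p)-valent. *)
definition sp_valent :: "nat \<Rightarrow> nat \<Rightarrow> (complex \<Rightarrow> complex) \<Rightarrow> complex set \<Rightarrow> bool" where
  "sp_valent s p f \<Omega> \<longleftrightarrow>
     open \<Omega> \<and> connected \<Omega> \<and> \<Omega> \<noteq> {} \<and> f holomorphic_on \<Omega> \<and>
     (\<forall>P :: complex poly. degree P \<le> s \<longrightarrow>
        finite {x \<in> \<Omega>. f x = poly P x} \<and> card {x \<in> \<Omega>. f x = poly P x} \<le> p)"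

(* Zeros are counted with multiplicity. Finiteness of the zero set excludes f = 0 identically on a
   nonempty open \<Omega>, where zorder would be unspecified. *)
definition has_exactly_zeros :: "(complex \<Rightarrow> complex) \<Rightarrow> complex set \<Rightarrow> nat \<Rightarrow> bool" where
  "has_exactly_zeros f \<Omega> s \<longleftrightarrow>
     finite {z \<in> \<Omega>. f z = 0} \<and> (\<Sum>z\<in>{z \<in> \<Omega>. f z = 0}. zorder f z) = int s"

(* Meaningful for bounded Z and d \<ge> 1, where the set of radius sums is nonempty and bounded below
   by 0. Allowing radius 0, or open instead of closed disks, does not change the infimum. *)
definition cover_radius :: "nat \<Rightarrow> complex set \<Rightarrow> real" where
  "cover_radius d Z =
     Inf {(\<Sum>i<d. r i) | (a :: nat \<Rightarrow> complex) (r :: nat \<Rightarrow> real).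
            (\<forall>i<d. 0 \<le> r i) \<and> Z \<subseteq> (\<Union>i<d. cball (a i) (r i))}"

definition sigma_factor :: "real \<Rightarrow> real \<Rightarrow> real" where
  "sigma_factor R R' = (((1 + R) * (1 + R')) / ((1 - R) * (1 - R')))\<^sup>2"

end

theory Submission imports Defs begin

text \<open>
  Divide the zeros out: \<open>f = P g\<close> with \<open>P\<close> monic of degree \<open>s\<close> and \<open>g\<close> without zeros. Comparing \<open>f\<close> with the
  polynomials \<open>w P\<close> shows that \<open>g\<close> takes every value at most \<open>p\<close> times. Cartan's lemma yields a point of \<open>Z\<close>
  at which \<open>\<bar>P\<bar> \<ge> (c/3e)\<^sup>s\<close>, while \<open>\<bar>P\<bar> \<le> 2\<^sup>s\<close> on the unit disc, so everything rests on a sharp distortion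
  theorem for \<open>g\<close>.

  Write \<open>g = exp (2 p k)\<close>. It suffices that \<open>\<bar>k'(0)\<bar> \<le> 2\<close>, because the hypothesis is invariant under
  automorphisms of the disc, and one may assume \<open>Re k(0) = 0\<close>. The metric \<open>\<bar>k'\<bar> / cosh (Re k)\<close> is the
  pull-back of the spherical metric under \<open>exp k\<close>. Since \<open>g\<close> is \<open>p\<close>-valent, each vertical line is covered by \<open>k\<close>
  with total length at most \<open>\<pi>\<close>, so the total area is at most \<open>2\<pi>\<close>, that of a hemisphere. If \<open>M(r)\<close> is the
  area of the disc of radius \<open>r\<close>, the isoperimetric inequality on the sphere gives
  \<open>2\<pi> r M' \<ge> M (4\<pi> - M)\<close>. Hence \<open>M / (r\<^sup>2 (4\<pi> - M))\<close> increases; it starts at \<open>\<bar>k'(0)\<bar>\<^sup>2 / 4\<close> and is at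
  most \<open>1 / r\<^sup>2\<close>.
\<close>

section \<open>Cartan's lemma\<close>

text \<open>Each disc of radius \<open>2 * j * \<delta>\<close> is charged to at least
  \<open>j\<close> indices that are removed with it, so the radii cost at most
  \<open>2 * \<delta>\<close> per index. Points are indexed by \<open>I\<close> so that a repeated
  zero keeps its multiplicity, and the discs form a list so that every radius is counted.\<close>

lemma Cartan_discs:
  fixes z :: "'i \<Rightarrow> complex" and \<delta> :: real
  assumes "finite I" "\<delta> > 0"
  shows "\<exists>L :: (complex \<times> real) list. length L \<le> card I \<and> (\<forall>(a, r) \<in> set L. 0 \<le> r) \<and>
     sum_list (map snd L) \<le> 2 * \<delta> * card I \<and>
     (\<forall>x. x \<notin> (\<Union>(a, r) \<in> set L. cball a r) \<longrightarrow>
        (\<forall>j\<ge>1. card {i \<in> I. dist x (z i) < real j * \<delta>} < j))"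
  using assms(1)
proof (induction "card I" arbitrary: I rule: less_induct)
  case less
  let ?J = "{j. 1 \<le> j \<and> (\<exists>a. j \<le> card {i \<in> I. dist a (z i) < real j * \<delta>})}"
  show ?case
  proof (cases "?J = {}")
    case True
    then have "card {i \<in> I. dist x (z i) < real j * \<delta>} < j" if "1 \<le> j" for x j
    proof -
      have "j \<notin> ?J" unfolding True by simp
      then show ?thesis using that by (auto simp: not_le)
    qed
    then show ?thesis by (intro exI[of _ "[]"]) (simp add: less_imp_le[OF assms(2)])
  next
    case False
    have J: "?J \<subseteq> {..card I}"
    proof
      fix j assume "j \<in> ?J"
      then obtain a where "j \<le> card {i \<in> I. dist a (z i) < real j * \<delta>}" by blast
      also have "\<dots> \<le> card I" using less.prems by (intro card_mono) auto
      finally show "j \<in> {..card I}" by simp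
    qed
    then have fin: "finite ?J" using finite_subset by blast
    \<comment> \<open>Greedy choice: by maximality of \<open>j\<close>, a disc of radius \<open>k \<delta>\<close> with \<open>k\<close> points has \<open>k \<le> j\<close>, so outside the
      doubled disc it contains none of the points removed here.\<close>
    define j where "j = Max ?J"
    have "j \<in> ?J" using Max_in[OF fin False] by (simp add: j_def)
    then obtain a where j: "1 \<le> j" and a: "j \<le> card {i \<in> I. dist a (z i) < real j * \<delta>}" by auto
    define I' where "I' = {i \<in> I. \<not> dist a (z i) < real j * \<delta>}"
    have fin': "finite I'" using less.prems by (simp add: I'_def)
    have "card I = card {i \<in> I. dist a (z i) < real j * \<delta>} + card I'"
      unfolding I'_def using less.prems
      by (subst card_Un_disjoint[symmetric]) (auto intro!: arg_cong[where f = card])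
    then have cI: "j + card I' \<le> card I" using a by simp
    then have "card I' < card I" using j by simp
    from less.hyps[OF this fin'] obtain L where
      L: "length L \<le> card I'" "\<forall>(a, r) \<in> set L. 0 \<le> r" "sum_list (map snd L) \<le> 2 * \<delta> * card I'"
      and out: "\<And>x k. x \<notin> (\<Union>(a, r) \<in> set L. cball a r) \<Longrightarrow> k \<ge> 1 \<Longrightarrow>
          card {i \<in> I'. dist x (z i) < real k * \<delta>} < k" by blast
    show ?thesis
    proof (intro exI[of _ "(a, 2 * real j * \<delta>) # L"] conjI allI impI)
      show "length ((a, 2 * real j * \<delta>) # L) \<le> card I" using L cI j by simp
      show "\<forall>(a, r)\<in>set ((a, 2 * real j * \<delta>) # L). 0 \<le> r" using L assms(2) by auto
      have "2 * \<delta> * (real j + real (card I')) \<le> 2 * \<delta> * real (card I)"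
        using cI assms(2) by (intro mult_left_mono) (auto simp flip: of_nat_add)
      then show "sum_list (map snd ((a, 2 * real j * \<delta>) # L)) \<le> 2 * \<delta> * real (card I)"
        using L by (simp add: algebra_simps)
      fix x and k :: nat
      assume x: "x \<notin> (\<Union>(a, r)\<in>set ((a, 2 * real j * \<delta>) # L). cball a r)" and k: "1 \<le> k"
      show "card {i \<in> I. dist x (z i) < real k * \<delta>} < k"
      proof (rule ccontr)
        assume "\<not> ?thesis"
        then have kc: "k \<le> card {i \<in> I. dist x (z i) < real k * \<delta>}" by simp
        then have "k \<in> ?J" using k by auto
        then have kj: "k \<le> j" using Max_ge[OF fin] by (simp add: j_def)
        have "{i \<in> I. dist x (z i) < real k * \<delta>} = {i \<in> I'. dist x (z i) < real k * \<delta>}"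
        proof -
          have "\<not> dist a (z i) < real j * \<delta>" if "dist x (z i) < real k * \<delta>" for i
          proof
            assume "dist a (z i) < real j * \<delta>"
            then have "dist a x < real j * \<delta> + real k * \<delta>"
              using that dist_triangle2[of a x "z i"] by linarith
            also have "\<dots> \<le> 2 * real j * \<delta>" using kj assms(2) by simp
            finally show False using x by simp
          qed
          then show ?thesis by (auto simp: I'_def)
        qed
        then show False using out[of x k] x k kc by auto
      qed
    qed
  qed
qed

text \<open>The hypothesis for \<open>j = card I\<close> yields a point at distance at least
  \<open>card I * \<delta>\<close>. Removing it and repeating gives the factors
  \<open>n \<delta>\<close>, \<open>(n-1) \<delta>\<close>, ..., \<open>\<delta>\<close>.\<close>

lemma prod_dist_ge_fact:
  fixes z :: "'i \<Rightarrow> complex" and \<delta> :: real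
  assumes "finite I" "\<delta> > 0" "\<And>j. 1 \<le> j \<Longrightarrow> card {i \<in> I. dist x (z i) < real j * \<delta>} < j"
  shows "fact (card I) * \<delta> ^ card I \<le> (\<Prod>i\<in>I. dist x (z i))"
  using assms(1,3)
proof (induction "card I" arbitrary: I)
  case 0
  then show ?case by simp
next
  case (Suc n)
  have "card {i \<in> I. dist x (z i) < real (Suc n) * \<delta>} < card I" using Suc by simp
  then have "{i \<in> I. dist x (z i) < real (Suc n) * \<delta>} \<noteq> I" by auto
  then obtain i where i: "i \<in> I" "real (Suc n) * \<delta> \<le> dist x (z i)" by force
  have "card {k \<in> I - {i}. dist x (z k) < real j * \<delta>} < j" if "1 \<le> j" for j
    by (rule order_le_less_trans[OF card_mono Suc.prems(2)[OF that]]) (use Suc in auto)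
  moreover have n: "n = card (I - {i})" using Suc i by simp
  ultimately have "fact n * \<delta> ^ n \<le> (\<Prod>k\<in>I - {i}. dist x (z k))"
    using Suc.hyps(1)[of "I - {i}"] Suc.prems(1) by simp
  then have "(real (Suc n) * \<delta>) * (fact n * \<delta> ^ n) \<le> dist x (z i) * (\<Prod>k\<in>I - {i}. dist x (z k))"
    using i assms(2) by (intro mult_mono) auto
  then show ?case
    unfolding Suc.hyps(2)[symmetric] prod.remove[OF Suc.prems(1) i(1)]
    by (simp only: fact_Suc power_Suc mult.assoc mult.left_commute)
qed

text \<open>\<open>n ^ n / n!\<close> is a single term of the exponential series at
  \<open>n\<close>.\<close>

lemma fact_ge_power_div_exp: "(real n / exp 1) ^ n \<le> fact n"
proof -
  have "real n ^ n /\<^sub>R fact n \<le> (\<Sum>k. real n ^ k /\<^sub>R fact k)"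
    using sum_le_suminf[OF summable_exp_generic[of "real n"], of "{n}"] by simp
  then have "real n ^ n / fact n \<le> exp (real n)" by (simp add: exp_def divide_inverse mult.commute)
  then show ?thesis by (simp add: power_divide field_simps flip: exp_of_nat_mult)
qed

lemma exists_point_prod_dist_ge:
  fixes z :: "'i \<Rightarrow> complex"
  assumes "finite I" "I \<noteq> {}" "cover_radius (card I) Z = c" "c > 0"
  obtains x where "x \<in> Z" "(c / (3 * exp 1)) ^ card I \<le> (\<Prod>i\<in>I. dist x (z i))"
proof -
  define n where "n = card I"
  have n: "n > 0" using assms by (simp add: n_def card_gt_0_iff)
  \<comment> \<open>With this choice the exceptional discs have total radius at most
    \<open>2 * c / 3 < c\<close>, so they cannot cover \<open>Z\<close>.\<close>
  define \<delta> where "\<delta> = c / (3 * real n)"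
  have \<delta>: "\<delta> > 0" using assms n by (simp add: \<delta>_def)
  obtain L where L: "length L \<le> n" "\<And>a r. (a, r) \<in> set L \<Longrightarrow> 0 \<le> r"
    "sum_list (map snd L) \<le> 2 * \<delta> * n"
    and out: "\<And>x j. x \<notin> (\<Union>(a, r) \<in> set L. cball a r) \<Longrightarrow> j \<ge> 1 \<Longrightarrow>
        card {i \<in> I. dist x (z i) < real j * \<delta>} < j"
    using Cartan_discs[OF assms(1) \<delta>, of z] unfolding n_def by fast
  \<comment> \<open>\<open>cover_radius\<close> asks for exactly \<open>n\<close> discs, while
    \<open>L\<close> may be shorter; the list is padded with discs of radius 0.\<close>
  define a where "a = (\<lambda>i. if i < length L then fst (L ! i) else 0)"
  define r where "r = (\<lambda>i. if i < length L then snd (L ! i) else 0)"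
  have "\<not> Z \<subseteq> (\<Union>(a, r) \<in> set L. cball a r)"
  proof
    assume Z: "Z \<subseteq> (\<Union>(a, r) \<in> set L. cball a r)"
    have r0: "0 \<le> r i" for i
      using L(2)[of "fst (L ! i)" "snd (L ! i)"] by (auto simp: r_def)
    have "Z \<subseteq> (\<Union>i<n. cball (a i) (r i))"
    proof
      fix x assume "x \<in> Z"
      then obtain b s where "(b, s) \<in> set L" "x \<in> cball b s" using Z by auto
      moreover then obtain i where "i < length L" "L ! i = (b, s)" by (metis in_set_conv_nth)
      ultimately show "x \<in> (\<Union>i<n. cball (a i) (r i))"
        using L(1) by (intro UN_I[of i]) (auto simp: a_def r_def)
    qed
    then have "cover_radius n Z \<le> (\<Sum>i<n. r i)"
      unfolding cover_radius_def using r0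
      by (intro cInf_lower bdd_belowI[of _ 0]) (auto intro!: sum_nonneg exI[of _ a] exI[of _ r])
    also have "(\<Sum>i<n. r i) = (\<Sum>i<length L. r i)"
      using L(1) by (intro sum.mono_neutral_right) (auto simp: r_def)
    also have "\<dots> = sum_list (map snd L)"
      by (simp add: sum_list_sum_nth r_def atLeast0LessThan)
    also have "\<dots> \<le> 2 * c / 3" using L(3) n by (simp add: \<delta>_def)
    finally show False using assms(3,4) by (simp add: n_def)
  qed
  then obtain x where x: "x \<in> Z" "x \<notin> (\<Union>(a, r) \<in> set L. cball a r)" by blast
  have "(c / (3 * exp 1)) ^ n = (real n / exp 1) ^ n * \<delta> ^ n"
    using n by (simp add: \<delta>_def power_mult_distrib[symmetric] mult.commute)
  also have "\<dots> \<le> fact n * \<delta> ^ n"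
    using \<delta> by (intro mult_right_mono fact_ge_power_div_exp) auto
  also have "\<dots> \<le> (\<Prod>i\<in>I. dist x (z i))"
    unfolding n_def by (rule prod_dist_ge_fact[OF assms(1) \<delta> out[OF x(2)]])
  finally show ?thesis using that x(1) by (simp add: n_def)
qed

section \<open>The isoperimetric inequality on the sphere\<close>

text \<open>An antiperiodic function has only half-integer frequencies, the lowest being 1/2, whence
  the factor 4. Antiperiodicity also forces a zero \<open>z\<close>; comparison with the extremal
  function \<open>sin ((x - z) / 2)\<close> shows that the integral of
  \<open>(u')\<^sup>2 - u\<^sup>2 / 4\<close> equals that of the square \<open>W\<close>.\<close>

lemma Wirtinger_antiperiodic:
  fixes u u' :: "real \<Rightarrow> real"
  assumes der: "\<And>x. x \<in> {0..2*pi} \<Longrightarrow> (u has_real_derivative u' x) (at x within {0..2*pi})"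
    and cont: "continuous_on {0..2*pi} u'"
    and anti: "u (2*pi) = - u 0"
  shows "integral {0..2*pi} (\<lambda>x. (u x)\<^sup>2) \<le> 4 * integral {0..2*pi} (\<lambda>x. (u' x)\<^sup>2)"
proof -
  have contu: "continuous_on {0..2*pi} u"
    using der DERIV_continuous_on by blast
  obtain z where z: "0 \<le> z" "z \<le> 2*pi" "u z = 0"
  proof (cases "u 0 \<le> 0")
    case True
    then show ?thesis using IVT'[of u 0 0 "2*pi"] contu anti that by auto
  next
    case False
    then show ?thesis using IVT2'[of u "2*pi" 0 0] contu anti that by auto
  qed
  \<comment> \<open>\<open>H\<close> is a primitive of \<open>(u')\<^sup>2 - u\<^sup>2 / 4 - W\<close>; at the zeros of the sine its value is the junk value \<open>0\<close>,
    which is also its limit there.\<close>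
  define H where "H = (\<lambda>x. (u x)\<^sup>2 / 2 * (cos ((x - z) / 2) / sin ((x - z) / 2)))"
  define W where "W = (\<lambda>x. (u' x - u x * (cos ((x - z) / 2) / sin ((x - z) / 2)) / 2)\<^sup>2)"
  define G where "G = (\<lambda>x. (u' x)\<^sup>2 - (u x)\<^sup>2 / 4)"
  \<comment> \<open>The sine vanishes only at \<open>z\<close>, or at the opposite endpoint when
    \<open>z\<close> is an endpoint; there \<open>u\<close> is 0 by antiperiodicity.\<close>
  have zero: "u x = 0" if "x \<in> {0..2*pi}" "sin ((x - z) / 2) = 0" for x
  proof -
    have "(x - z) / 2 = 0 \<or> (x - z) / 2 = pi \<or> (x - z) / 2 = - pi"
    proof (rule ccontr)
      assume *: "\<not> ?thesis"
      have "- pi \<le> (x - z) / 2" "(x - z) / 2 \<le> pi" using that(1) z by (auto simp: field_simps)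
      then have "0 < \<bar>(x - z) / 2\<bar>" "\<bar>(x - z) / 2\<bar> < pi" using * by linarith+
      then have "sin \<bar>(x - z) / 2\<bar> > 0" by (rule sin_gt_zero)
      then show False using that(2) sin_minus[of "(x - z) / 2"] by (simp add: abs_if del: minus_divide_left split: if_splits)
    qed
    then have "x = z \<or> (x = 2*pi \<and> z = 0) \<or> (x = 0 \<and> z = 2*pi)"
      using that z by auto
    then show ?thesis using z anti by auto
  qed
  have nz: "sin ((x - z) / 2) \<noteq> 0" if "x \<in> {0<..<2*pi} - {z}" for x
  proof -
    have "- pi < (x - z) / 2" "(x - z) / 2 < pi" "(x - z) / 2 \<noteq> 0"
      using that z by (auto simp: field_simps)
    then have "0 < \<bar>(x - z) / 2\<bar>" "\<bar>(x - z) / 2\<bar> < pi" by linarith+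
    then have "sin \<bar>(x - z) / 2\<bar> > 0" by (rule sin_gt_zero)
    then show ?thesis using sin_minus[of "(x - z) / 2"] by (auto simp: abs_if split: if_splits)
  qed
  have derH: "(H has_vector_derivative (G x - W x)) (at x)" if x: "x \<in> {0<..<2*pi} - {z}" for x
  proof -
    have [derivative_intros]: "(u has_real_derivative u' x) (at x)"
      using der[of x] x by (simp add: at_within_Icc_at)
    define C S where "C = cos ((x - z) / 2)" and "S = sin ((x - z) / 2)"
    have S0: "S \<noteq> 0" and CS: "C * C = 1 - S * S"
      using nz[OF x] cos_squared_eq[of "(x - z) / 2"] by (auto simp: C_def S_def power2_eq_square)
    have "((\<lambda>x. cos ((x - z) / 2) / sin ((x - z) / 2)) has_real_derivative
        (- S * (1 / 2) * S - C * (C * (1 / 2))) / (S * S)) (at x)"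
      unfolding C_def S_def using nz[OF x] by (auto intro!: derivative_eq_intros)
    also have "(- S * (1 / 2) * S - C * (C * (1 / 2))) / (S * S) = - 1 / (2 * (S * S))"
      unfolding mult.assoc[symmetric] CS using S0 by (simp add: CS divide_simps) 
    finally have K: "((\<lambda>x. cos ((x - z) / 2) / sin ((x - z) / 2)) has_real_derivative - 1 / (2 * (S * S))) (at x)" .
    have u2: "((\<lambda>x. (u x)\<^sup>2 / 2) has_real_derivative u x * u' x) (at x)"
      by (auto intro!: derivative_eq_intros)
    have "(H has_real_derivative u x * u' x * (C / S) + - 1 / (2 * (S * S)) * ((u x)\<^sup>2 / 2)) (at x)"
      unfolding H_def C_def S_def by (rule DERIV_mult[OF u2 K[unfolded S_def]])
    also have "u x * u' x * (C / S) + - 1 / (2 * (S * S)) * ((u x)\<^sup>2 / 2) = G x - W x"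
    proof -
      have k: "(C / S) * (C / S) = 1 / (S * S) - 1" using S0 CS by (simp add: field_simps)
      have "G x - W x = u x * u' x * (C / S) - (u x)\<^sup>2 / 4 * ((C / S) * (C / S)) - (u x)\<^sup>2 / 4"
        unfolding G_def W_def C_def[symmetric] S_def[symmetric]
        by (simp only: power2_diff) (simp add: power2_eq_square algebra_simps)
      moreover have "- 1 / (2 * (S * S)) * ((u x)\<^sup>2 / 2) = - ((u x)\<^sup>2 / 4 * (1 / (S * S)))"
        by simp
      ultimately show ?thesis unfolding k right_diff_distrib by linarith
    qed
    finally have "(H has_real_derivative (G x - W x)) (at x)" .
    then show ?thesis by (simp add: has_real_derivative_iff_has_vector_derivative)
  qed
  have contH: "continuous_on {0..2*pi} H"
    unfolding continuous_on_eq_continuous_within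
  proof
    fix w assume w: "w \<in> {0..2*pi}"
    show "continuous (at w within {0..2*pi}) H"
    proof (cases "sin ((w - z) / 2) = 0")
      case False
      have "continuous (at w within {0..2*pi}) u"
        using contu w by (auto simp: continuous_on_eq_continuous_within)
      then show ?thesis using False unfolding H_def by (intro continuous_intros) auto
    next
      case True
      have uw: "u w = 0" using zero[OF w True] .
      let ?F = "at w within {0..2*pi}"
      have 1: "((\<lambda>x. (u x - u w) / (x - w)) \<longlongrightarrow> u' w) ?F"
        using der[OF w] by (simp add: has_field_derivative_iff)
      have "((\<lambda>x. sin ((x - z) / 2)) has_real_derivative cos ((w - z) / 2) / 2) ?F"
        by (auto intro!: derivative_eq_intros)
      then have 2: "((\<lambda>x. (sin ((x - z) / 2) - sin ((w - z) / 2)) / (x - w)) \<longlongrightarrow> cos ((w - z) / 2) / 2) ?F"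
        by (simp add: has_field_derivative_iff)
      have c: "cos ((w - z) / 2) / 2 \<noteq> 0" using True by (metis cos_zero_iff_int divide_eq_0_iff sin_cos_squared_add power_zero_numeral add_0 zero_neq_one zero_neq_numeral)
      have 3: "(u \<longlongrightarrow> 0) ?F"
        using contu w uw by (metis continuous_on_def)
      have 4: "((\<lambda>x. cos ((x - z) / 2)) \<longlongrightarrow> cos ((w - z) / 2)) ?F"
        by (intro tendsto_intros) auto
      \<comment> \<open>Up to a bounded factor, \<open>H\<close> is \<open>u\<close> times a ratio
        of two difference quotients. The ratio converges because the sine has a simple zero at
        \<open>w\<close>, while \<open>u\<close> tends to 0.\<close>
      have "((\<lambda>x. u x * (((u x - u w) / (x - w)) / ((sin ((x - z) / 2) - sin ((w - z) / 2)) / (x - w))) / 2 * cos ((x - z) / 2))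
          \<longlongrightarrow> 0 * (u' w / (cos ((w - z) / 2) / 2)) / 2 * cos ((w - z) / 2)) ?F"
        by (rule tendsto_mult[OF tendsto_divide[OF tendsto_mult[OF 3 tendsto_divide[OF 1 2 c]] tendsto_const] 4]) simp
      then have "((\<lambda>x. u x * (((u x - u w) / (x - w)) / ((sin ((x - z) / 2) - sin ((w - z) / 2)) / (x - w))) / 2 * cos ((x - z) / 2)) \<longlongrightarrow> 0) ?F"
        by simp
      then have "(H \<longlongrightarrow> 0) ?F"
      proof (rule Lim_transform_eventually)
        show "\<forall>\<^sub>F x in ?F. u x * (((u x - u w) / (x - w)) / ((sin ((x - z) / 2) - sin ((w - z) / 2)) / (x - w))) / 2 * cos ((x - z) / 2) = H x"
          unfolding eventually_at_filter
          by (intro always_eventually) (auto simp: H_def True uw power2_eq_square)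
      qed
      then show ?thesis by (simp add: continuous_within H_def uw)
    qed
  qed
  have "((\<lambda>x. G x - W x) has_integral (H (2*pi) - H 0)) {0..2*pi}"
    by (rule fundamental_theorem_of_calculus_interior_strong[where S = "{z}"])
       (use derH contH in auto)
  \<comment> \<open>The cotangent of \<open>(x - z) / 2\<close> has period \<open>2*pi\<close> and
    \<open>u\<close> only changes sign, so the boundary terms cancel.\<close>
  moreover have "H (2*pi) = H 0"
  proof -
    have "(2*pi - z) / 2 = pi - z / 2" "(0 - z) / 2 = - (z / 2)" by (simp_all add: field_simps)
    then have "sin ((2*pi - z) / 2) = sin (z / 2)" "cos ((2*pi - z) / 2) = - cos (z / 2)"
      "sin ((0 - z) / 2) = - sin (z / 2)" "cos ((0 - z) / 2) = cos (z / 2)"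
      by (simp_all only: sin_pi_minus cos_pi_minus sin_minus cos_minus)
    then show ?thesis unfolding H_def anti by simp
  qed
  ultimately have GW: "((\<lambda>x. G x - W x) has_integral 0) {0..2*pi}" by simp
  have i1: "(\<lambda>x. (u' x)\<^sup>2) integrable_on {0..2*pi}" "(\<lambda>x. (u x)\<^sup>2) integrable_on {0..2*pi}"
    by (intro integrable_continuous_real continuous_intros cont contu)+
  have G: "(G has_integral (integral {0..2*pi} (\<lambda>x. (u' x)\<^sup>2) - integral {0..2*pi} (\<lambda>x. (u x)\<^sup>2) / 4)) {0..2*pi}"
    unfolding G_def using i1 by (intro has_integral_diff has_integral_divide integrable_integral)
  have "((\<lambda>x. G x - (G x - W x)) has_integral (integral {0..2*pi} (\<lambda>x. (u' x)\<^sup>2) - integral {0..2*pi} (\<lambda>x. (u x)\<^sup>2) / 4 - 0)) {0..2*pi}"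
    by (intro has_integral_diff G GW)
  then have "0 \<le> integral {0..2*pi} (\<lambda>x. (u' x)\<^sup>2) - integral {0..2*pi} (\<lambda>x. (u x)\<^sup>2) / 4 - 0"
    by (rule has_integral_nonneg) (simp add: W_def)
  then show ?thesis by simp
qed

text \<open>The closed curve \<open>exp (t + \<i> \<phi>)\<close> on the sphere is lifted to the unit sphere of \<open>\<complex>\<^sup>2\<close> as
  \<open>(C exp (\<i> p), S exp (\<i> m))\<close>, with the phase \<open>\<psi>\<close> chosen so that the component of the velocity along the
  Hopf fibre is the constant \<open>b\<close>. The lift is then antiperiodic, and Wirtinger's inequality applies to its
  four real components.\<close>

lemma spherical_isoperimetric:
  fixes t \<phi> t' \<phi>' :: "real \<Rightarrow> real"
  assumes t: "\<And>x. x \<in> {0..2*pi} \<Longrightarrow> (t has_real_derivative t' x) (at x within {0..2*pi})"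
    and \<phi>: "\<And>x. x \<in> {0..2*pi} \<Longrightarrow> (\<phi> has_real_derivative \<phi>' x) (at x within {0..2*pi})"
    and cont: "continuous_on {0..2*pi} t'" "continuous_on {0..2*pi} \<phi>'"
    and per: "t (2*pi) = t 0" "\<phi> (2*pi) = \<phi> 0"
    and M: "M = integral {0..2*pi} (\<lambda>x. tanh (t x) * \<phi>' x)"
  shows "M * (4*pi - M) \<le> 2*pi * integral {0..2*pi} (\<lambda>x. (1 - (tanh (t x))\<^sup>2) * ((t' x)\<^sup>2 + (\<phi>' x)\<^sup>2))"
proof -
  let ?I = "{0..2*pi}"
  \<comment> \<open>This value makes the phase \<open>\<psi>\<close> fall by exactly
    \<open>pi\<close> over the period, so that the lift changes sign.\<close>
  define b where "b = (M / (2*pi) - 1) / 2"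
  \<comment> \<open>\<open>(C, S)\<close> is the unit vector with positive entries and
    \<open>C / S = exp t\<close>.\<close>
  define C where "C = (\<lambda>x. sqrt ((1 + tanh (t x)) / 2))"
  define S where "S = (\<lambda>x. sqrt ((1 - tanh (t x)) / 2))"
  define \<psi> where "\<psi> = (\<lambda>x. integral {0..x} (\<lambda>x. b - tanh (t x) * \<phi>' x / 2))"
  have ct: "continuous_on ?I t" and c\<phi>: "continuous_on ?I \<phi>"
    by (rule DERIV_continuous_on, erule t) (rule DERIV_continuous_on, erule \<phi>)
  have th: "-1 < tanh (t x)" "tanh (t x) < 1" for x
    using tanh_real_gt_neg1 tanh_real_lt_1 by auto
  have CS: "C x > 0" "S x > 0" "(C x)\<^sup>2 = (1 + tanh (t x)) / 2" "(S x)\<^sup>2 = (1 - tanh (t x)) / 2" for x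
    using th[of x] by (simp_all add: C_def S_def)
  have th': "((\<lambda>x. tanh (t x)) has_real_derivative (1 - (tanh (t x))\<^sup>2) * t' x) (at x within ?I)" if "x \<in> ?I" for x
    using t[OF that] by (auto intro!: derivative_eq_intros)
  have sech: "1 - (tanh (t x))\<^sup>2 = 4 * (C x)\<^sup>2 * (S x)\<^sup>2" for x
    unfolding CS by (simp add: power2_eq_square field_simps)
  have C': "(C has_real_derivative C x * (S x)\<^sup>2 * t' x) (at x within ?I)" if "x \<in> ?I" for x
  proof -
    have "((\<lambda>x. (1 + tanh (t x)) / 2) has_real_derivative (1 - (tanh (t x))\<^sup>2) * t' x / 2) (at x within ?I)"
      using DERIV_cdivide[OF DERIV_add[OF DERIV_const th'[OF that]], of 1 2] by simp
    then have "(C has_real_derivative inverse (C x) / 2 * ((1 - (tanh (t x))\<^sup>2) * t' x / 2)) (at x within ?I)"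
      unfolding C_def by (intro DERIV_chain2[of sqrt] DERIV_real_sqrt) (use th[of x] in auto)
    also have "inverse (C x) / 2 * ((1 - (tanh (t x))\<^sup>2) * t' x / 2) = C x * (S x)\<^sup>2 * t' x"
      unfolding sech using CS(1)[of x] by (simp add: field_simps power2_eq_square)
    finally show ?thesis .
  qed
  have S': "(S has_real_derivative - (S x * (C x)\<^sup>2 * t' x)) (at x within ?I)" if "x \<in> ?I" for x
  proof -
    have "((\<lambda>x. (1 - tanh (t x)) / 2) has_real_derivative - ((1 - (tanh (t x))\<^sup>2) * t' x) / 2) (at x within ?I)"
      using DERIV_cdivide[OF DERIV_diff[OF DERIV_const th'[OF that]], of 1 2] by simp
    then have "(S has_real_derivative inverse (S x) / 2 * (- ((1 - (tanh (t x))\<^sup>2) * t' x) / 2)) (at x within ?I)"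
      unfolding S_def by (intro DERIV_chain2[of sqrt] DERIV_real_sqrt) (use th[of x] in auto)
    also have "inverse (S x) / 2 * (- ((1 - (tanh (t x))\<^sup>2) * t' x) / 2) = - (S x * (C x)\<^sup>2 * t' x)"
      unfolding sech using CS(2)[of x] by (simp add: field_simps power2_eq_square)
    finally show ?thesis .
  qed
  have cCS: "continuous_on ?I C" "continuous_on ?I S"
    by (rule DERIV_continuous_on, erule C') (rule DERIV_continuous_on, erule S')
  have \<psi>': "(\<psi> has_real_derivative b - tanh (t x) * \<phi>' x / 2) (at x within ?I)" if "x \<in> ?I" for x
    unfolding \<psi>_def
    by (rule integral_has_real_derivative[OF _ that]) (auto intro!: continuous_intros ct cont)
  have c\<psi>: "continuous_on ?I \<psi>"
    by (rule DERIV_continuous_on, erule \<psi>')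
  have iM: "(\<lambda>x. tanh (t x) * \<phi>' x) integrable_on ?I"
    by (auto intro!: integrable_continuous_real continuous_intros ct cont)
  have \<psi>0: "\<psi> 0 = 0" by (simp add: \<psi>_def)
  have \<psi>2: "\<psi> (2*pi) = - pi"
  proof -
    have "((\<lambda>x. b - tanh (t x) * \<phi>' x / 2) has_integral (2*pi * b - M / 2)) ?I"
      using has_integral_diff[OF has_integral_const_real[of b 0 "2*pi"] has_integral_divide[OF integrable_integral[OF iM], of 2]]
      by (simp add: M)
    then have "\<psi> (2*pi) = 2*pi * b - M / 2"
      unfolding \<psi>_def by (rule integral_unique)
    also have "\<dots> = - pi"
      by (simp add: b_def field_simps)
    finally show ?thesis .
  qed
  \<comment> \<open>Since \<open>p - m = \<phi>\<close>, the quotient of the two lifted components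
    is the original curve \<open>exp (t + \<i> \<phi>)\<close>.\<close>
  define p where "p = (\<lambda>x. \<psi> x + \<phi> x / 2)"
  define m where "m = (\<lambda>x. \<psi> x - \<phi> x / 2)"
  have p': "(p has_real_derivative b + (S x)\<^sup>2 * \<phi>' x) (at x within ?I)" if "x \<in> ?I" for x
    unfolding p_def using \<psi>'[OF that] \<phi>[OF that]
    by (auto intro!: derivative_eq_intros simp: CS field_simps)
  have m': "(m has_real_derivative b - (C x)\<^sup>2 * \<phi>' x) (at x within ?I)" if "x \<in> ?I" for x
    unfolding m_def using \<psi>'[OF that] \<phi>[OF that]
    by (auto intro!: derivative_eq_intros simp: CS field_simps)
  have cpm: "continuous_on ?I p" "continuous_on ?I m"
    unfolding p_def m_def by (intro continuous_intros c\<psi> c\<phi>; simp)+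
  have pm: "p (2*pi) = p 0 - pi" "m (2*pi) = m 0 - pi" "C (2*pi) = C 0" "S (2*pi) = S 0"
    by (simp_all add: p_def m_def C_def S_def per \<psi>0 \<psi>2)
  define u where "u = (\<lambda>i::nat. if i = 0 then (\<lambda>x. C x * cos (p x)) else if i = 1 then (\<lambda>x. C x * sin (p x))
     else if i = 2 then (\<lambda>x. S x * cos (m x)) else (\<lambda>x. S x * sin (m x)))"
  define u' where "u' = (\<lambda>i::nat.
     if i = 0 then (\<lambda>x. C x * (S x)\<^sup>2 * t' x * cos (p x) - C x * (sin (p x) * (b + (S x)\<^sup>2 * \<phi>' x)))
     else if i = 1 then (\<lambda>x. C x * (S x)\<^sup>2 * t' x * sin (p x) + C x * (cos (p x) * (b + (S x)\<^sup>2 * \<phi>' x)))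
     else if i = 2 then (\<lambda>x. - (S x * (C x)\<^sup>2 * t' x) * cos (m x) - S x * (sin (m x) * (b - (C x)\<^sup>2 * \<phi>' x)))
     else (\<lambda>x. - (S x * (C x)\<^sup>2 * t' x) * sin (m x) + S x * (cos (m x) * (b - (C x)\<^sup>2 * \<phi>' x))))"
  have u': "(u i has_real_derivative u' i x) (at x within ?I)" if "x \<in> ?I" for i x
    using C'[OF that] S'[OF that] p'[OF that] m'[OF that]
    unfolding u_def u'_def by (auto intro!: derivative_eq_intros)
  have cu: "continuous_on ?I (u i)" and cu': "continuous_on ?I (u' i)" for i
    unfolding u_def u'_def by (auto intro!: continuous_intros cCS cpm cont)
  have anti: "u i (2*pi) = - u i 0" for i
    unfolding u_def by (simp add: pm cos_diff sin_diff)
  have W: "integral ?I (\<lambda>x. (u i x)\<^sup>2) \<le> 4 * integral ?I (\<lambda>x. (u' i x)\<^sup>2)" for i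
    by (rule Wirtinger_antiperiodic[OF u' cu' anti])
  have rot0: "(a * cos y)\<^sup>2 + (a * sin y)\<^sup>2 = a\<^sup>2" for a y :: real
    by (simp add: power_mult_distrib flip: distrib_left)
  have sum4: "(\<Sum>i<4. h i) = (h 0 + h 1) + (h 2 + h 3)" for h :: "nat \<Rightarrow> real"
    by (simp add: eval_nat_numeral)
  have sq1: "(\<Sum>i<4. (u i x)\<^sup>2) = 1" for x
  proof -
    have "(\<Sum>i<4. (u i x)\<^sup>2) = (C x)\<^sup>2 + (S x)\<^sup>2"
      unfolding rot0[symmetric, of "C x" "p x"] rot0[symmetric, of "S x" "m x"] sum4 u_def by simp
    then show ?thesis by (simp add: CS field_simps)
  qed
  have rot: "(a * cos y - d * (sin y * q))\<^sup>2 + (a * sin y + d * (cos y * q))\<^sup>2 = a\<^sup>2 + d\<^sup>2 * q\<^sup>2" for a d q y :: real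
  proof -
    have "(a * v - d * (w * q))\<^sup>2 + (a * w + d * (v * q))\<^sup>2 = (a\<^sup>2 + d\<^sup>2 * q\<^sup>2) * (w\<^sup>2 + v\<^sup>2)" for v w :: real
      by (simp add: power2_eq_square algebra_simps)
    then show ?thesis by simp
  qed
  \<comment> \<open>The squared speed of the lift splits into the fibre part
    \<open>b\<^sup>2\<close> and a quarter of the squared speed on the unit sphere, because the Hopf
    map doubles horizontal lengths.\<close>
  have sq2: "(\<Sum>i<4. (u' i x)\<^sup>2) = b\<^sup>2 + (1 - (tanh (t x))\<^sup>2) * ((t' x)\<^sup>2 + (\<phi>' x)\<^sup>2) / 4" for x
  proof -
    have one: "(C x)\<^sup>2 + (S x)\<^sup>2 = 1" by (simp add: CS field_simps)
    have "(\<Sum>i<4. (u' i x)\<^sup>2) =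
        ((u' 0 x)\<^sup>2 + (u' 1 x)\<^sup>2) + ((u' 2 x)\<^sup>2 + (u' 3 x)\<^sup>2)"
      by (rule sum4)
    also have "\<dots> = ((C x * (S x)\<^sup>2 * t' x)\<^sup>2 + (C x)\<^sup>2 * (b + (S x)\<^sup>2 * \<phi>' x)\<^sup>2)
        + ((- (S x * (C x)\<^sup>2 * t' x))\<^sup>2 + (S x)\<^sup>2 * (b - (C x)\<^sup>2 * \<phi>' x)\<^sup>2)"
      unfolding u'_def
        rot[symmetric, of "C x * (S x)\<^sup>2 * t' x" "C x" "b + (S x)\<^sup>2 * \<phi>' x" "p x"]
        rot[symmetric, of "- (S x * (C x)\<^sup>2 * t' x)" "S x" "b - (C x)\<^sup>2 * \<phi>' x" "m x"]
      by simp
    also have "\<dots> = ((C x)\<^sup>2 + (S x)\<^sup>2) * (b\<^sup>2 + (C x)\<^sup>2 * (S x)\<^sup>2 * ((t' x)\<^sup>2 + (\<phi>' x)\<^sup>2))"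
      by (simp only: power2_eq_square) (simp add: algebra_simps)
    also have "\<dots> = b\<^sup>2 + (1 - (tanh (t x))\<^sup>2) * ((t' x)\<^sup>2 + (\<phi>' x)\<^sup>2) / 4"
      unfolding sech one by simp
    finally show ?thesis .
  qed
  define E where "E = integral ?I (\<lambda>x. (1 - (tanh (t x))\<^sup>2) * ((t' x)\<^sup>2 + (\<phi>' x)\<^sup>2))"
  have iE: "(\<lambda>x. (1 - (tanh (t x))\<^sup>2) * ((t' x)\<^sup>2 + (\<phi>' x)\<^sup>2)) integrable_on ?I"
    by (auto intro!: integrable_continuous_real continuous_intros ct cont)
  have "2 * pi = integral ?I (\<lambda>x. \<Sum>i<4. (u i x)\<^sup>2)"
    by (simp add: sq1)
  also have "\<dots> = (\<Sum>i<4. integral ?I (\<lambda>x. (u i x)\<^sup>2))"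
    by (intro integral_sum integrable_continuous_real continuous_intros cu) auto
  also have "\<dots> \<le> (\<Sum>i<4. 4 * integral ?I (\<lambda>x. (u' i x)\<^sup>2))"
    by (intro sum_mono W)
  also have "\<dots> = 4 * integral ?I (\<lambda>x. \<Sum>i<4. (u' i x)\<^sup>2)"
    unfolding sum_distrib_left[symmetric]
    by (subst integral_sum) (auto intro!: integrable_continuous_real continuous_intros cu')
  also have "integral ?I (\<lambda>x. \<Sum>i<4. (u' i x)\<^sup>2) = 2*pi * b\<^sup>2 + E / 4"
    using has_integral_add[OF has_integral_const_real[of "b\<^sup>2" 0 "2*pi"] has_integral_divide[OF integrable_integral[OF iE], of 4]]
    unfolding sq2 E_def by (intro integral_unique) simp
  \<comment> \<open>Multiplied by \<open>2*pi\<close> this reads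
    \<open>(2*pi)\<^sup>2 \<le> (M - 2*pi)\<^sup>2 + 2*pi * E\<close>, and
    \<open>(2*pi)\<^sup>2 - (M - 2*pi)\<^sup>2 = M * (4*pi - M)\<close>.\<close>
  finally have "2*pi \<le> 8*pi * b\<^sup>2 + E" by simp
  then have "2*pi * (2*pi) \<le> 2*pi * (8*pi * b\<^sup>2 + E)"
    by (intro mult_left_mono) auto
  also have "2*pi * (8*pi * b\<^sup>2 + E) = (M - 2*pi)\<^sup>2 + 2*pi * E"
    by (simp add: b_def field_simps power2_eq_square)
  finally show ?thesis
    unfolding E_def by (simp add: power2_eq_square algebra_simps)
qed

section \<open>Spherical area of a holomorphic disc\<close>

lemma DERIV_tanh_at: "(tanh has_real_derivative 1 - (tanh x)\<^sup>2) (at x)"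
  by (rule has_field_derivative_tanh[of "\<lambda>x. x", OF _ DERIV_ident, simplified]) simp

lemma DERIV_tanh_mult:
  fixes a b :: "real \<Rightarrow> real"
  assumes "(a has_real_derivative a') (at x within S)" "(b has_real_derivative b') (at x within S)"
  shows "((\<lambda>x. tanh (a x) * b x) has_real_derivative
    (1 - (tanh (a x))\<^sup>2) * a' * b x + tanh (a x) * b') (at x within S)"
  using DERIV_mult[OF DERIV_chain2[OF DERIV_tanh_at assms(1)] assms(2)]
  by (simp add: mult.commute)

locale disc_function =
  fixes k :: "complex \<Rightarrow> complex"
  assumes holo: "k holomorphic_on ball 0 1"
begin

definition pt :: "real \<Rightarrow> real \<Rightarrow> complex" where "pt r \<theta> = of_real r * cis \<theta>"

text \<open>By Stokes, \<open>flux r\<close> is the spherical area of the image of the disc of radius \<open>r\<close> under \<open>exp k\<close>.\<close>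

definition flux :: "real \<Rightarrow> real" where
  "flux r = integral {0..2*pi} (\<lambda>\<theta>. tanh (Re (k (pt r \<theta>))) * Re (pt r \<theta> * deriv k (pt r \<theta>)))"

text \<open>The pull-back of the spherical area element in polar coordinates:
  \<open>1 - tanh\<^sup>2\<close> is \<open>1 / cosh\<^sup>2\<close>, and the leading
  \<open>r\<close> is the polar Jacobian.\<close>

definition density :: "real \<Rightarrow> real \<Rightarrow> real" where
  "density r \<theta> = r * ((1 - (tanh (Re (k (pt r \<theta>))))\<^sup>2) * (cmod (deriv k (pt r \<theta>)))\<^sup>2)"

lemma pt_in: "\<bar>r\<bar> < 1 \<Longrightarrow> pt r \<theta> \<in> ball 0 1"
  by (simp add: pt_def norm_mult)

lemma holo1: "deriv k holomorphic_on ball 0 1" and holo2: "deriv (deriv k) holomorphic_on ball 0 1"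
  using holo by (auto intro!: holomorphic_deriv)

lemma der1: "z \<in> ball 0 1 \<Longrightarrow> (k has_field_derivative deriv k z) (at z)"
  and der2: "z \<in> ball 0 1 \<Longrightarrow> (deriv k has_field_derivative deriv (deriv k) z) (at z)"
  using holo holo1 holomorphic_derivI by blast+

lemma continuous_pt [continuous_intros]: "continuous_on A (\<lambda>(r, \<theta>). pt r \<theta>)"
  unfolding pt_def case_prod_beta cis_conv_exp by (intro continuous_intros)

lemma continuous_pt2: "continuous_on A (pt r)"
  unfolding pt_def cis_conv_exp by (intro continuous_intros)

lemma continuous_along:
  assumes "g holomorphic_on ball 0 1"
  shows "continuous_on ({-1<..<1} \<times> A) (\<lambda>(r, \<theta>). g (pt r \<theta>))"
proof -
  have "(\<lambda>(r, \<theta>). pt r \<theta>) ` ({-1<..<1} \<times> A) \<subseteq> ball 0 1"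
  proof
    fix w assume "w \<in> (\<lambda>(r, \<theta>). pt r \<theta>) ` ({-1<..<1} \<times> A)"
    then obtain r \<theta> where "w = pt r \<theta>" "-1 < r" "r < 1" by auto
    then show "w \<in> ball 0 1" using pt_in[of r \<theta>] by (auto simp: abs_less_iff)
  qed
  from continuous_on_compose2[OF holomorphic_on_imp_continuous_on[OF assms] continuous_pt this]
  show ?thesis by (simp add: case_prod_beta)
qed

lemma pt_radial: "((\<lambda>r. pt r \<theta>) has_vector_derivative cis \<theta>) (at r within A)"
  unfolding pt_def by (auto intro!: derivative_eq_intros simp: has_vector_derivative_def scaleR_conv_of_real)

lemma pt_angular: "(pt r has_vector_derivative \<i> * pt r \<theta>) (at \<theta> within A)"
proof -
  have "((\<lambda>x. exp (\<i> * complex_of_real x)) has_vector_derivative (\<i> * exp (\<i> * complex_of_real \<theta>))) (at \<theta> within A)"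
    by (rule has_vector_derivative_real_field) (auto intro!: derivative_eq_intros)
  then have "((\<lambda>x. of_real r * exp (\<i> * complex_of_real x)) has_vector_derivative of_real r * (\<i> * exp (\<i> * complex_of_real \<theta>))) (at \<theta> within A)"
    by (rule has_vector_derivative_mult_right)
  then show ?thesis unfolding pt_def cis_conv_exp by (simp add: mult_ac)
qed

lemma along_radial:
  assumes "(g has_field_derivative g') (at (pt r \<theta>))"
  shows "((\<lambda>r. g (pt r \<theta>)) has_vector_derivative (cis \<theta> * g')) (at r within A)"
  using field_vector_diff_chain_within[of "\<lambda>r. pt r \<theta>", OF pt_radial, of g g'] assms
  by (auto simp: o_def intro: has_field_derivative_at_within)

lemma along_angular:
  assumes "(g has_field_derivative g') (at (pt r \<theta>))"
  shows "((\<lambda>\<theta>. g (pt r \<theta>)) has_vector_derivative (\<i> * pt r \<theta> * g')) (at \<theta> within A)"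
  using field_vector_diff_chain_within[of "pt r", OF pt_angular, of g g'] assms
  by (auto simp: o_def intro: has_field_derivative_at_within)

section \<open>Differentiating the boundary integral: Stokes' theorem in infinitesimal form\<close>

definition flux' :: "real \<Rightarrow> real \<Rightarrow> real" where
  "flux' r \<theta> = (1 - (tanh (Re (k (pt r \<theta>))))\<^sup>2) * Re (cis \<theta> * deriv k (pt r \<theta>)) * Re (pt r \<theta> * deriv k (pt r \<theta>))
     + tanh (Re (k (pt r \<theta>))) * Re (cis \<theta> * deriv k (pt r \<theta>) + pt r \<theta> * (cis \<theta> * deriv (deriv k) (pt r \<theta>)))"

lemma flux_derivative:
  assumes "\<bar>r\<bar> < 1"
  shows "(flux has_real_derivative integral {0..2*pi} (flux' r)) (at r)"
proof -
  let ?U = "{-1<..<1::real}"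
  have "((\<lambda>r. integral (cbox 0 (2*pi)) (\<lambda>\<theta>. tanh (Re (k (pt r \<theta>))) * Re (pt r \<theta> * deriv k (pt r \<theta>))))
      has_real_derivative integral (cbox 0 (2*pi)) (flux' r)) (at r within ?U)"
  proof (rule leibniz_rule_field_derivative)
    fix r \<theta> assume "r \<in> ?U"
    then have p: "pt r \<theta> \<in> ball 0 1" by (intro pt_in) auto
    have "((\<lambda>r. Re (k (pt r \<theta>))) has_real_derivative Re (cis \<theta> * deriv k (pt r \<theta>))) (at r within ?U)"
      by (intro has_field_derivative_Re along_radial der1 p)
    moreover have "((\<lambda>r. Re (pt r \<theta> * deriv k (pt r \<theta>))) has_real_derivative
        Re (cis \<theta> * deriv k (pt r \<theta>) + pt r \<theta> * (cis \<theta> * deriv (deriv k) (pt r \<theta>)))) (at r within ?U)"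
      using has_vector_derivative_mult[OF pt_radial along_radial[OF der2[OF p]]]
      by (intro has_field_derivative_Re) (simp add: add.commute)
    ultimately show "((\<lambda>r. tanh (Re (k (pt r \<theta>))) * Re (pt r \<theta> * deriv k (pt r \<theta>)))
        has_real_derivative flux' r \<theta>) (at r within ?U)"
      unfolding flux'_def by (rule DERIV_tanh_mult)
  next
    fix r assume "r \<in> ?U"
    then have r: "\<bar>r\<bar> < 1" by auto
    have c: "continuous_on (cbox 0 (2*pi)) (\<lambda>\<theta>. g (pt r \<theta>))" if "g holomorphic_on ball 0 1" for g
      by (rule continuous_on_compose2[OF holomorphic_on_imp_continuous_on[OF that] continuous_pt2]) (use pt_in[OF r] in auto)
    show "(\<lambda>\<theta>. tanh (Re (k (pt r \<theta>))) * Re (pt r \<theta> * deriv k (pt r \<theta>))) integrable_on cbox 0 (2*pi)"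
      by (intro integrable_continuous continuous_intros c holo holo1 continuous_pt2) auto
  next
    have cc: "continuous_on A (\<lambda>x. cis (snd x))" for A :: "(real \<times> real) set"
      unfolding cis_conv_exp by (intro continuous_intros)
    note c = continuous_along[of _ "cbox 0 (2*pi)", unfolded case_prod_beta]
    show "continuous_on (?U \<times> cbox 0 (2*pi)) (\<lambda>(r, \<theta>). flux' r \<theta>)"
      unfolding flux'_def case_prod_beta
      by (intro continuous_intros c holo holo1 holo2 cc continuous_pt[unfolded case_prod_beta]) auto
  qed (use assms in auto)
  moreover have "at r within ?U = at r"
    using assms by (intro at_within_open) auto
  ultimately show ?thesis
    unfolding flux_def[abs_def] cbox_interval by simp
qed

text \<open>Differentiation in \<open>r\<close> produces only the square of
  \<open>Re (z * deriv k z)\<close>, plus a term with the second derivative. By the Cauchy-Riemann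
  equations that term, less the missing square of \<open>Im (z * deriv k z)\<close>, is an exact
  angular derivative and integrates to 0 over the circle.\<close>

lemma integral_flux':
  assumes "0 < r" "r < 1"
  shows "integral {0..2*pi} (flux' r) = integral {0..2*pi} (density r)"
proof -
  let ?I = "{0..2*pi}"
  have p: "pt r \<theta> \<in> ball 0 1" for \<theta> using assms by (intro pt_in) auto
  have c: "continuous_on ?I (\<lambda>\<theta>. g (pt r \<theta>))" if "g holomorphic_on ball 0 1" for g
    by (rule continuous_on_compose2[OF holomorphic_on_imp_continuous_on[OF that] continuous_pt2]) (use p in auto)
  \<comment> \<open>The two integrands differ by the angular derivative of the periodic function \<open>B\<close>.\<close>
  define B where "B = (\<lambda>\<theta>. tanh (Re (k (pt r \<theta>))) * Im (pt r \<theta> * deriv k (pt r \<theta>)) / r)"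
  define B' where "B' = (\<lambda>\<theta>. ((1 - (tanh (Re (k (pt r \<theta>))))\<^sup>2) * Re (\<i> * pt r \<theta> * deriv k (pt r \<theta>)) * Im (pt r \<theta> * deriv k (pt r \<theta>))
     + tanh (Re (k (pt r \<theta>))) * Im (\<i> * pt r \<theta> * deriv k (pt r \<theta>) + pt r \<theta> * (\<i> * pt r \<theta> * deriv (deriv k) (pt r \<theta>)))) / r)"
  have "(B has_vector_derivative B' \<theta>) (at \<theta> within ?I)" for \<theta>
  proof -
    have "((\<lambda>\<theta>. Re (k (pt r \<theta>))) has_real_derivative Re (\<i> * pt r \<theta> * deriv k (pt r \<theta>))) (at \<theta> within ?I)"
      by (intro has_field_derivative_Re along_angular der1 p)
    moreover have "((\<lambda>\<theta>. Im (pt r \<theta> * deriv k (pt r \<theta>))) has_real_derivative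
        Im (\<i> * pt r \<theta> * deriv k (pt r \<theta>) + pt r \<theta> * (\<i> * pt r \<theta> * deriv (deriv k) (pt r \<theta>)))) (at \<theta> within ?I)"
      using has_vector_derivative_mult[OF pt_angular along_angular[OF der2[OF p]]]
      by (intro has_field_derivative_Im) (simp add: add.commute)
    ultimately have "(B has_real_derivative B' \<theta>) (at \<theta> within ?I)"
      unfolding B_def B'_def by (intro DERIV_cdivide DERIV_tanh_mult)
    then show ?thesis by (simp add: has_real_derivative_iff_has_vector_derivative)
  qed
  then have B: "(B' has_integral (B (2*pi) - B 0)) ?I"
    by (intro fundamental_theorem_of_calculus) auto
  have "B (2*pi) = B 0" by (simp add: B_def pt_def)
  with B have B: "(B' has_integral 0) ?I" by simp
  have eq: "flux' r \<theta> = density r \<theta> + B' \<theta>" for \<theta>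
  proof -
    define x where "x = pt r \<theta>"
    define q where "q = x * deriv k x"
    define T where "T = tanh (Re (k x))"
    have cis: "cis \<theta> = x / of_real r" using assms by (simp add: x_def pt_def)
    have "cmod q = r * cmod (deriv k x)" using assms by (simp add: q_def x_def pt_def norm_mult)
    then have n: "(cmod (deriv k x))\<^sup>2 = ((Re q)\<^sup>2 + (Im q)\<^sup>2) / r\<^sup>2"
      using assms by (simp add: cmod_power2[symmetric] power_mult_distrib)
    have 1: "Re (cis \<theta> * deriv k x) = Re q / r"
      unfolding cis q_def by simp
    have 2: "Re (cis \<theta> * deriv k x + x * (cis \<theta> * deriv (deriv k) x)) = Re (q + x * x * deriv (deriv k) x) / r"
    proof -
      have "cis \<theta> * deriv k x + x * (cis \<theta> * deriv (deriv k) x) = (q + x * x * deriv (deriv k) x) / of_real r"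
        unfolding cis q_def by (simp add: algebra_simps add_divide_distrib)
      then show ?thesis by simp
    qed
    have 3: "Re (\<i> * x * deriv k x) = - Im q" unfolding q_def mult.assoc by simp
    have 4: "Im (\<i> * x * deriv k x + x * (\<i> * x * deriv (deriv k) x)) = Re (q + x * x * deriv (deriv k) x)"
    proof -
      have "\<i> * x * deriv k x + x * (\<i> * x * deriv (deriv k) x) = \<i> * (q + x * x * deriv (deriv k) x)"
        unfolding q_def by (simp add: algebra_simps)
      then show ?thesis by simp
    qed
    have "flux' r \<theta> = (1 - T\<^sup>2) * (Re q / r) * Re q + T * (Re (q + x * x * deriv (deriv k) x) / r)"
      unfolding flux'_def x_def[symmetric] 1 2 T_def[symmetric] q_def[symmetric] ..
    moreover have "density r \<theta> = (1 - T\<^sup>2) * ((Re q)\<^sup>2 + (Im q)\<^sup>2) / r"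
      unfolding density_def x_def[symmetric] T_def[symmetric] n using assms by (simp add: power2_eq_square)
    moreover have "B' \<theta> = ((1 - T\<^sup>2) * (- Im q) * Im q + T * Re (q + x * x * deriv (deriv k) x)) / r"
      unfolding B'_def x_def[symmetric] 3 4 T_def[symmetric] q_def[symmetric] ..
    moreover have "X * (a / r) * a + y * (K / r) = X * (a\<^sup>2 + b\<^sup>2) / r + (X * (- b) * b + y * K) / r"
      for X a b y K :: real
      by (simp add: power2_eq_square add_divide_distrib diff_divide_distrib distrib_left)
    ultimately show ?thesis by simp
  qed
  have "density r integrable_on ?I"
    unfolding density_def by (intro integrable_continuous_real continuous_intros c holo holo1) auto
  from has_integral_add[OF integrable_integral[OF this] B]
  show ?thesis unfolding eq by (simp add: integral_unique)
qed

lemma continuous_density: "continuous_on ({-1<..<1} \<times> A) (\<lambda>(r, \<theta>). density r \<theta>)"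
  unfolding density_def case_prod_beta
  by (intro continuous_intros continuous_along[unfolded case_prod_beta] holo holo1) auto

lemma flux_has_derivative:
  assumes "0 < r" "r < 1"
  shows "(flux has_real_derivative integral {0..2*pi} (density r)) (at r)"
  using flux_derivative[of r] integral_flux'[OF assms] assms by simp

lemma flux_0: "flux 0 = 0"
  by (simp add: flux_def pt_def)

lemma continuous_flux: "0 \<le> r \<Longrightarrow> r < 1 \<Longrightarrow> continuous_on {0..r} flux"
  by (intro continuous_at_imp_continuous_on ballI DERIV_isCont[OF flux_derivative]) auto

text \<open>The derivative formula is integrated from 0; at the endpoint 0, which it excludes,
  continuity of \<open>flux\<close> is enough.\<close>

lemma flux_eq_area:
  assumes "0 \<le> r" "r < 1"
  shows "flux r = integral {0..r} (\<lambda>s. integral {0..2*pi} (density s))"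
proof -
  have "((\<lambda>s. integral {0..2*pi} (density s)) has_integral (flux r - flux 0)) {0..r}"
    using assms flux_has_derivative continuous_flux
    by (intro fundamental_theorem_of_calculus_interior)
       (auto simp flip: has_real_derivative_iff_has_vector_derivative)
  then show ?thesis by (simp add: flux_0 integral_unique)
qed

text \<open>The isoperimetric inequality is applied to the curve \<open>k (pt r \<theta>)\<close>,
  which closes up because \<open>k\<close> is single-valued. By conformality its spherical energy is
  \<open>r\<close> times the derivative of the area, so the result is a differential inequality for
  \<open>flux\<close>.\<close>

lemma flux_differential_inequality:
  assumes "0 < r" "r < 1"
  shows "flux r * (4*pi - flux r) \<le> 2*pi * r * integral {0..2*pi} (density r)"
proof -
  let ?I = "{0..2*pi}"
  have p: "pt r \<theta> \<in> ball 0 1" for \<theta> using assms by (intro pt_in) auto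
  have c: "continuous_on ?I (\<lambda>\<theta>. g (pt r \<theta>))" if "g holomorphic_on ball 0 1" for g
    by (rule continuous_on_compose2[OF holomorphic_on_imp_continuous_on[OF that] continuous_pt2]) (use p in auto)
  define t' where "t' = (\<lambda>\<theta>. Re (\<i> * pt r \<theta> * deriv k (pt r \<theta>)))"
  define \<phi>' where "\<phi>' = (\<lambda>\<theta>. Im (\<i> * pt r \<theta> * deriv k (pt r \<theta>)))"
  have "flux r * (4*pi - flux r) \<le> 2*pi * integral ?I (\<lambda>x. (1 - (tanh (Re (k (pt r x))))\<^sup>2) * ((t' x)\<^sup>2 + (\<phi>' x)\<^sup>2))"
  proof (rule spherical_isoperimetric)
    fix \<theta>
    show "((\<lambda>\<theta>. Re (k (pt r \<theta>))) has_real_derivative t' \<theta>) (at \<theta> within ?I)"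
      unfolding t'_def by (intro has_field_derivative_Re along_angular der1 p)
    show "((\<lambda>\<theta>. Im (k (pt r \<theta>))) has_real_derivative \<phi>' \<theta>) (at \<theta> within ?I)"
      unfolding \<phi>'_def by (intro has_field_derivative_Im along_angular der1 p)
  next
    show "continuous_on ?I t'" "continuous_on ?I \<phi>'"
      unfolding t'_def \<phi>'_def by (intro continuous_intros c holo1 continuous_pt2)+
    show "flux r = integral ?I (\<lambda>x. tanh (Re (k (pt r x))) * \<phi>' x)"
      by (simp add: flux_def \<phi>'_def mult.assoc)
  qed (simp_all add: pt_def)
  also have "(\<lambda>x. (1 - (tanh (Re (k (pt r x))))\<^sup>2) * ((t' x)\<^sup>2 + (\<phi>' x)\<^sup>2)) = (\<lambda>x. r * density r x)"
  proof
    fix x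
    have "(t' x)\<^sup>2 + (\<phi>' x)\<^sup>2 = (cmod (\<i> * pt r x * deriv k (pt r x)))\<^sup>2"
      unfolding t'_def \<phi>'_def by (rule cmod_power2[symmetric])
    also have "\<dots> = r\<^sup>2 * (cmod (deriv k (pt r x)))\<^sup>2"
      by (simp add: norm_mult pt_def power_mult_distrib)
    finally show "(1 - (tanh (Re (k (pt r x))))\<^sup>2) * ((t' x)\<^sup>2 + (\<phi>' x)\<^sup>2) = r * density r x"
      by (simp add: density_def power2_eq_square)
  qed
  finally show ?thesis by simp
qed

lemma density_nonneg: "0 \<le> r \<Longrightarrow> 0 \<le> density r \<theta>"
proof -
  have "(tanh (Re (k (pt r \<theta>))))\<^sup>2 \<le> 1"
    using tanh_real_lt_1[of "Re (k (pt r \<theta>))"] tanh_real_gt_neg1[of "Re (k (pt r \<theta>))"]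
    by (auto simp: abs_square_le_1)
  then show "0 \<le> r \<Longrightarrow> 0 \<le> density r \<theta>" by (simp add: density_def)
qed

end

section \<open>Area and multiplicity\<close>

text \<open>On each piece the integral is the measure of the image, and the images overlap at most
  \<open>p\<close>-fold inside \<open>T\<close>. Differentiability is asked only within each piece,
  so that \<open>g\<close> may jump from one piece to another.\<close>

lemma integral_Jacobian_le_multiplicity_measure:
  fixes g :: "real^'n::{finite,wellorder} \<Rightarrow> real^'n::_"
  assumes A: "\<And>i::nat. A i \<in> sets lebesgue" and disj: "disjoint_family A"
    and der: "\<And>i x. x \<in> A i \<Longrightarrow> (g has_derivative g' x) (at x within A i)"
    and inj: "\<And>i. inj_on g (A i)"
    and int: "(\<lambda>x. \<bar>det (matrix (g' x))\<bar>) absolutely_integrable_on (\<Union>i. A i)"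
    and T: "g ` (\<Union>i. A i) \<subseteq> T" "T \<in> lmeasurable"
    and mult: "\<And>y. finite {x \<in> (\<Union>i. A i). g x = y} \<and> card {x \<in> (\<Union>i. A i). g x = y} \<le> p"
  shows "integral (\<Union>i. A i) (\<lambda>x. \<bar>det (matrix (g' x))\<bar>) \<le> real p * measure lebesgue T"
proof -
  define S where "S = (\<Union>i. A i)"
  define D where "D = (\<lambda>x. \<bar>det (matrix (g' x))\<bar>)"
  have SD: "set_integrable lebesgue S D"
    using int by (simp add: S_def D_def)
  have Ai: "set_integrable lebesgue (A i) D" for i
    by (rule set_integrable_subset[OF SD]) (use A in \<open>auto simp: S_def\<close>)
  have img: "g ` A i \<in> lmeasurable \<and> measure lebesgue (g ` A i) = integral (A i) D" for i
  proof -
    have "D integrable_on A i"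
      using Ai[of i] by (simp add: set_lebesgue_integral_eq_integral)
    then show ?thesis
      using measurable_differentiable_image_eq[OF A der inj]
        measure_differentiable_image_eq[OF A der inj] by (simp add: D_def)
  qed
  \<comment> \<open>With nonnegative extended integrals the sum over the pieces commutes with
    integration.\<close>
  have eq: "ennreal (integral B D) = (\<integral>\<^sup>+x. ennreal (indicator B x *\<^sub>R D x) \<partial>lebesgue)"
    if "set_integrable lebesgue B D" for B
  proof -
    have "integral B D = (LINT x|lebesgue. indicator B x *\<^sub>R D x)"
      using set_lebesgue_integral_eq_integral(2)[OF that] by (simp add: set_lebesgue_integral_def)
    then show ?thesis
      using that unfolding set_integrable_def
      by (subst nn_integral_eq_integral) (auto simp: D_def)
  qed
  have split: "ennreal (indicator S x *\<^sub>R D x) = (\<Sum>i. ennreal (indicator (A i) x *\<^sub>R D x))" for x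
  proof -
    have "(\<Sum>i. ennreal (indicator (A i) x *\<^sub>R D x)) = (\<Sum>i. ennreal (D x) * indicator (A i) x)"
      by (intro suminf_cong) (auto simp: indicator_def)
    also have "\<dots> = ennreal (D x) * indicator S x"
      using suminf_indicator[OF disj, of x] by (simp add: S_def)
    finally show ?thesis by (auto simp: indicator_def)
  qed
  have count: "(\<Sum>i. indicator (g ` A i) y :: ennreal) \<le> of_nat p * indicator T y" for y
  proof (rule suminf_le_const)
    fix n
    let ?I = "{i \<in> {..<n}. y \<in> g ` A i}"
    \<comment> \<open>The pieces are disjoint, so those whose images contain \<open>y\<close> supply
      distinct preimages of \<open>y\<close>; hence there are at most \<open>p\<close> of
      them.\<close>
    define x where "x = (\<lambda>i. SOME x. x \<in> A i \<and> g x = y)"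
    have x: "x i \<in> A i \<and> g (x i) = y" if "i \<in> ?I" for i
      unfolding x_def by (rule someI_ex) (use that in auto)
    have "inj_on x ?I"
      using x disj unfolding inj_on_def disjoint_family_on_def by (metis IntI UNIV_I empty_iff)
    moreover have "x ` ?I \<subseteq> {x \<in> S. g x = y}"
      using x by (auto simp: S_def)
    ultimately have "card ?I \<le> card {x \<in> S. g x = y}"
      using mult[of y] by (auto simp: S_def intro!: card_inj_on_le)
    then have le: "card ?I \<le> p" using mult[of y] by (simp add: S_def)
    have "(\<Sum>i<n. indicator (g ` A i) y :: ennreal) = of_nat (card ?I)"
    proof -
      have "(\<Sum>i<n. indicator (g ` A i) y :: ennreal) = (\<Sum>i<n. if y \<in> g ` A i then 1 else 0)"
        by (intro sum.cong) (auto simp: indicator_def)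
      also have "\<dots> = (\<Sum>i\<in>?I. 1)"
        by (intro sum.inter_filter[symmetric]) auto
      finally show ?thesis by simp
    qed
    moreover have "?I = {}" if "y \<notin> T" using T that by auto
    ultimately show "(\<Sum>i<n. indicator (g ` A i) y :: ennreal) \<le> of_nat p * indicator T y"
      using le by (cases "y \<in> T") (auto simp: of_nat_mono)
  qed auto
  have "ennreal (integral S D) = (\<Sum>i. \<integral>\<^sup>+x. ennreal (indicator (A i) x *\<^sub>R D x) \<partial>lebesgue)"
    unfolding eq[OF SD] split
    by (rule nn_integral_suminf)
       (use Ai in \<open>auto simp: set_integrable_def intro!: measurable_compose[OF borel_measurable_integrable measurable_ennreal]\<close>)
  also have "\<dots> = (\<Sum>i. emeasure lebesgue (g ` A i))"
    using img eq[OF Ai] by (simp add: emeasure_eq_measure2)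
  also have "\<dots> = (\<integral>\<^sup>+y. (\<Sum>i. indicator (g ` A i) y) \<partial>lebesgue)"
    using fmeasurableD[OF conjunct1[OF img]] by (subst nn_integral_suminf) auto
  also have "\<dots> \<le> (\<integral>\<^sup>+y. of_nat p * indicator T y \<partial>lebesgue)"
    by (intro nn_integral_mono count)
  also have "\<dots> = of_nat p * emeasure lebesgue T"
    using T by (simp add: nn_integral_cmult_indicator)
  also have "\<dots> = ennreal (real p * measure lebesgue T)"
    using T by (simp add: emeasure_eq_measure2 ennreal_mult ennreal_of_nat_eq_real_of_nat)
  finally show ?thesis
    by (simp add: S_def D_def)
qed

text \<open>This links the change of variables, carried out in \<open>real^2\<close>, with iterated
  integrals over pairs: the coordinate bijection takes boxes to boxes of equal content.\<close>

lemma integral_cbox_real2: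
  fixes F :: "real \<Rightarrow> real \<Rightarrow> real"
  assumes "continuous_on (cbox (a, c) (b, d)) (\<lambda>(x, y). F x y)"
  shows "((\<lambda>v::real^2. F (v $ 1) (v $ 2)) has_integral
     (integral {a..b} (\<lambda>x. integral {c..d} (F x)))) (cbox (vector [a, c]) (vector [b, d]))"
proof -
  define g :: "real^2 \<Rightarrow> real \<times> real" where "g = (\<lambda>v. (v $ 1, v $ 2))"
  define h :: "real \<times> real \<Rightarrow> real^2" where "h = (\<lambda>(x, y). vector [x, y])"
  have hg: "h (g v) = v" for v
    by (simp add: h_def g_def vec_eq_iff forall_2)
  have gh: "g (h z) = z" for z
    by (simp add: h_def g_def split: prod.splits)
  have gbox: "g ` cbox u v = cbox (g u) (g v)" for u v
  proof -
    have "g ` cbox u v = {z. h z \<in> cbox u v}"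
    proof (intro equalityI subsetI)
      fix z assume "z \<in> {z. h z \<in> cbox u v}"
      then show "z \<in> g ` cbox u v" using gh[of z] by (metis imageI mem_Collect_eq)
    qed (use hg in auto)
    also have "\<dots> = cbox (g u) (g v)"
      by (auto simp: h_def g_def mem_box_cart forall_2 cbox_Pair_eq)
    finally show ?thesis .
  qed
  have hbox: "h ` cbox z w = cbox (h z) (h w)" for z w
  proof -
    have "h ` cbox z w = h ` (g ` cbox (h z) (h w))"
      by (simp add: gbox gh)
    then show ?thesis by (simp add: image_image hg)
  qed
  have content: "measure lborel (g ` cbox u v) = 1 * measure lborel (cbox u v)" for u v
  proof -
    have ex2: "(\<exists>i::2. P i) \<longleftrightarrow> P 1 \<or> P 2" for P
      using forall_2[of "\<lambda>i. \<not> P i"] by blast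
    have 1: "measure lborel (cbox u v) = (if u $ 1 \<le> v $ 1 \<and> u $ 2 \<le> v $ 2 then (v $ 1 - u $ 1) * (v $ 2 - u $ 2) else 0)"
      by (auto simp: content_cbox_if_cart interval_eq_empty_cart ex2 forall_2 prod_2 UNIV_2 not_less)
    show ?thesis unfolding gbox 1
      unfolding g_def content_Pair by auto
  qed
  have int: "((\<lambda>(x, y). F x y) has_integral
      integral {a..b} (\<lambda>x. integral {c..d} (F x))) (cbox (a, c) (b, d))"
    using integral_prod_continuous[OF assms] integrable_continuous[OF assms]
    by (simp add: has_integral_iff)
  have cg: "continuous (at x) g" for x
    unfolding g_def by (intro continuous_intros)
  have "((\<lambda>x. (\<lambda>(x, y). F x y) (g x)) has_integral
      (1 / 1) *\<^sub>R integral {a..b} (\<lambda>x. integral {c..d} (F x))) (h ` cbox (a, c) (b, d))"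
    by (rule has_integral_twiddle[OF zero_less_one hg gh cg _ _ content int])
       (use gbox hbox in blast)+
  then show ?thesis by (simp add: hbox g_def) (simp add: h_def)
qed

lemma has_derivative_vector_2:
  fixes a b :: "'a::real_normed_vector \<Rightarrow> real"
  assumes "(a has_derivative a') (at x within S)" "(b has_derivative b') (at x within S)"
  shows "((\<lambda>x. vector [a x, b x] :: real^2) has_derivative (\<lambda>h. vector [a' h, b' h])) (at x within S)"
proof (subst has_derivative_componentwise_within, intro ballI)
  fix i :: "real^2" assume "i \<in> Basis"
  then obtain j where i: "i = axis j 1" by (auto simp: Basis_vec_def)
  show "((\<lambda>x. vector [a x, b x] \<bullet> i) has_derivative (\<lambda>h. vector [a' h, b' h] \<bullet> i)) (at x within S)"
    using assms exhaust_2[of j] unfolding i inner_axis by auto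
qed

lemma cis_inj:
  assumes "cis a = cis b" "0 < a" "a < 2*pi" "0 < b" "b < 2*pi"
  shows "a = b"
proof -
  have "exp (\<i> * complex_of_real a) = exp (\<i> * complex_of_real b)"
    using assms(1) by (simp add: cis_conv_exp)
  then obtain n :: int where n: "\<i> * complex_of_real a = \<i> * complex_of_real b + of_int (2 * n) * (of_real pi * \<i>)"
    by (auto simp: exp_eq)
  have "Im (\<i> * complex_of_real a) = Im (\<i> * complex_of_real b + of_int (2 * n) * (of_real pi * \<i>))"
    by (simp only: n)
  then have ab: "a = b + 2 * (of_int n * pi)" by simp
  then have "- 1 * pi < of_int n * pi" "of_int n * pi < 1 * pi" using assms by linarith+
  then have "-1 < real_of_int n" "real_of_int n < 1"
    by (simp_all only: mult_less_cancel_right_pos[OF pi_gt_zero])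
  then have "n = 0" by linarith
  then show ?thesis using ab by simp
qed

section \<open>The area-preserving chart on the polar rectangle\<close>

context disc_function begin

lemma pt_inj:
  assumes "pt r a = pt s b" "0 < r" "0 < s" "0 < a" "a < 2*pi" "0 < b" "b < 2*pi"
  shows "r = s \<and> a = b"
proof -
  have "cmod (pt r a) = cmod (pt s b)" using assms by simp
  then have "r = s" using assms by (simp add: pt_def norm_mult)
  moreover have "cis a = cis b" using assms(1,2) \<open>r = s\<close> by (simp add: pt_def)
  ultimately show ?thesis using cis_inj assms by blast
qed

abbreviation ptv :: "real^2 \<Rightarrow> complex" where "ptv v \<equiv> pt (v $ 1) (v $ 2)"

lemma ptv_derivative:
  "(ptv has_derivative (\<lambda>h. of_real (h $ 1) * cis (v $ 2) + of_real (h $ 2) * (\<i> * ptv v))) (at v within S)"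
proof -
  have 1: "((\<lambda>v::real^2. complex_of_real (v $ 1)) has_derivative (\<lambda>h. of_real (h $ 1))) (at v within S)"
    by (rule has_derivative_of_real[OF bounded_linear_imp_has_derivative[OF bounded_linear_vec_nth]])
  have 2: "((\<lambda>v::real^2. cis (v $ 2)) has_derivative (\<lambda>h. of_real (h $ 2) * (\<i> * cis (v $ 2)))) (at v within S)"
  proof -
    have "(cis has_vector_derivative \<i> * cis (v $ 2)) (at (v $ 2))"
      using pt_angular[of 1 "v $ 2" UNIV] by (simp add: pt_def[abs_def])
    then have "(cis has_derivative (\<lambda>h. h *\<^sub>R (\<i> * cis (v $ 2)))) (at (v $ 2))"
      by (simp add: has_vector_derivative_def)
    from has_derivative_compose[OF bounded_linear_imp_has_derivative[OF bounded_linear_vec_nth] this]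
    show ?thesis
      by (simp add: scaleR_conv_of_real)
  qed
  show ?thesis
    unfolding pt_def by (rule has_derivative_eq_rhs[OF has_derivative_mult[OF 1 2]]) (auto simp: algebra_simps)
qed

text \<open>In the coordinates \<open>(tanh (Re k), Im k)\<close> spherical area becomes Lebesgue measure.\<close>

definition chart :: "real^2 \<Rightarrow> real^2" where
  "chart v = vector [tanh (Re (k (ptv v))), Im (k (ptv v))]"

definition chart' :: "real^2 \<Rightarrow> real^2 \<Rightarrow> real^2" where
  "chart' v h = (let w = (of_real (h $ 1) * cis (v $ 2) + of_real (h $ 2) * (\<i> * ptv v)) * deriv k (ptv v) in
     vector [(1 - (tanh (Re (k (ptv v))))\<^sup>2) * Re w, Im w])"

lemma chart_derivative:
  fixes v :: "real^2"
  assumes "\<bar>v $ 1\<bar> < 1"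
  shows "(chart has_derivative chart' v) (at v within S)"
proof -
  have "(k has_derivative (\<lambda>h. deriv k (ptv v) * h)) (at (ptv v))"
    using der1[OF pt_in[OF assms]] by (simp add: has_field_derivative_def)
  from has_derivative_compose[OF ptv_derivative this]
  have k: "((\<lambda>v. k (ptv v)) has_derivative (\<lambda>h. (of_real (h $ 1) * cis (v $ 2) + of_real (h $ 2) * (\<i> * ptv v)) * deriv k (ptv v))) (at v within S)"
    by (simp add: mult.commute)
  have re: "((\<lambda>v. Re (k (ptv v))) has_derivative (\<lambda>h. Re ((of_real (h $ 1) * cis (v $ 2) + of_real (h $ 2) * (\<i> * ptv v)) * deriv k (ptv v)))) (at v within S)"
    by (rule has_derivative_Re[OF k])
  have im: "((\<lambda>v. Im (k (ptv v))) has_derivative (\<lambda>h. Im ((of_real (h $ 1) * cis (v $ 2) + of_real (h $ 2) * (\<i> * ptv v)) * deriv k (ptv v)))) (at v within S)"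
    by (rule has_derivative_Im[OF k])
  have "(tanh has_derivative (\<lambda>h. (1 - (tanh (Re (k (ptv v))))\<^sup>2) * h)) (at (Re (k (ptv v))))"
    using DERIV_tanh_at[of "Re (k (ptv v))"] by (simp add: has_field_derivative_def)
  from has_derivative_compose[OF re this]
  show ?thesis
    unfolding chart_def[abs_def] chart'_def[abs_def] Let_def by (rule has_derivative_vector_2[OF _ im])
qed

text \<open>By the Cauchy-Riemann equations \<open>k\<close> has Jacobian
  \<open>r * |k'|\<^sup>2\<close> in polar coordinates, and \<open>tanh\<close> scales only the
  first row.\<close>

lemma chart_Jacobian:
  fixes v :: "real^2"
  shows "det (matrix (chart' v)) = density (v $ 1) (v $ 2)"
proof -
  define \<alpha> where "\<alpha> = cis (v $ 2) * deriv k (ptv v)"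
  define X where "X = 1 - (tanh (Re (k (ptv v))))\<^sup>2"
  have w: "(of_real (axis (1::2) 1 $ 1) * cis (v $ 2) + of_real (axis (1::2) 1 $ 2) * (\<i> * ptv v)) * deriv k (ptv v) = \<alpha>"
    "(of_real (axis (2::2) 1 $ 1) * cis (v $ 2) + of_real (axis (2::2) 1 $ 2) * (\<i> * ptv v)) * deriv k (ptv v) = \<i> * (of_real (v $ 1) * \<alpha>)"
    by (simp_all add: axis_def \<alpha>_def pt_def)
  have "chart' v (axis 1 1) = vector [X * Re \<alpha>, Im \<alpha>]"
    "chart' v (axis 2 1) = vector [X * - (v $ 1 * Im \<alpha>), v $ 1 * Re \<alpha>]"
    unfolding chart'_def Let_def w X_def by simp_all
  then have "det (matrix (chart' v)) = X * Re \<alpha> * (v $ 1 * Re \<alpha>) - X * (- (v $ 1 * Im \<alpha>)) * Im \<alpha>"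
    unfolding det_2 matrix_def by simp
  also have "\<dots> = v $ 1 * (X * (cmod \<alpha>)\<^sup>2)"
    unfolding cmod_power2 by (simp add: power2_eq_square algebra_simps)
  also have "cmod \<alpha> = cmod (deriv k (ptv v))"
    by (simp add: \<alpha>_def norm_mult)
  finally show ?thesis by (simp add: density_def X_def)
qed


lemma continuous_ptv: "continuous_on A ptv"
  using has_derivative_continuous_on[OF ptv_derivative] .

lemma chart_eq_iff: "chart v = chart w \<longleftrightarrow> k (ptv v) = k (ptv w)"
  by (auto simp: chart_def vec_eq_iff forall_2 complex_eq_iff)

text \<open>\<open>k\<close> is injective near a noncritical point and \<open>tanh\<close> is
  injective everywhere. The open box avoids the origin and the slit, so polar coordinates are
  injective on it.\<close>

lemma chart_locally_inj:
  fixes v :: "real^2"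
  assumes v: "v \<in> box (vector [0, 0]) (vector [r, 2*pi])" and r: "r < 1" and nz: "deriv k (ptv v) \<noteq> 0"
  obtains N where "open N" "v \<in> N" "N \<subseteq> box (vector [0, 0]) (vector [r, 2*pi])" "inj_on chart N"
proof -
  let ?Q = "box (vector [0, 0]) (vector [r, 2*pi]) :: (real^2) set"
  have Q: "w \<in> ?Q \<longleftrightarrow> 0 < w $ 1 \<and> w $ 1 < r \<and> 0 < w $ 2 \<and> w $ 2 < 2*pi" for w
    by (auto simp: mem_box_cart forall_2)
  have "ptv v \<in> ball 0 1" using v r by (intro pt_in) (auto simp: Q)
  then obtain \<rho> where \<rho>: "\<rho> > 0" "inj_on k (ball (ptv v) \<rho>)"
    using has_complex_derivative_locally_injective[OF holo _ _ nz] by auto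
  define N where "N = ?Q \<inter> ptv -` ball (ptv v) \<rho>"
  have "inj_on chart N"
  proof (rule inj_onI)
    fix x y assume x: "x \<in> N" and y: "y \<in> N" and "chart x = chart y"
    then have "ptv x = ptv y"
      using \<rho> by (auto simp: chart_eq_iff N_def inj_on_def)
    then show "x = y"
      using pt_inj[of "x $ 1" "x $ 2" "y $ 1" "y $ 2"] x y
      by (auto simp: N_def Q vec_eq_iff forall_2)
  qed
  moreover have "open N"
    unfolding N_def by (intro open_Int open_box open_vimage open_ball continuous_ptv)
  ultimately show ?thesis using that[of N] v \<rho>(1) by (auto simp: N_def)
qed

text \<open>The chart with second coordinate reduced modulo \<open>pi / p\<close> maps into a
  rectangle of area \<open>2 * pi / p\<close>, covering each point at most \<open>p\<close> times;
  the product is \<open>2 * pi\<close>.\<close>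

lemma area_le_multiplicity:
  fixes p :: nat
  assumes p: "p \<ge> 1"
    and val: "\<And>w. finite {x \<in> ball 0 1. exp (2 * of_nat p * k x) = w} \<and>
      card {x \<in> ball 0 1. exp (2 * of_nat p * k x) = w} \<le> p"
    and r: "0 < r" "r < 1"
  shows "flux r \<le> 2*pi"
proof -
  let ?Q = "box (vector [0, 0]) (vector [r, 2*pi]) :: (real^2) set"
  let ?C = "cbox (vector [0, 0]) (vector [r, 2*pi]) :: (real^2) set"
  let ?D = "\<lambda>v::real^2. density (v $ 1) (v $ 2)"
  have Q: "w \<in> ?Q \<longleftrightarrow> 0 < w $ 1 \<and> w $ 1 < r \<and> 0 < w $ 2 \<and> w $ 2 < 2*pi" for w
    by (auto simp: mem_box_cart forall_2)
  have QB: "ptv w \<in> ball 0 1" if "w \<in> ?Q" for w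
    using that r by (intro pt_in) (auto simp: Q)
  have contQ: "continuous_on ?Q (\<lambda>v. g (ptv v))" if "g holomorphic_on ball 0 1" for g
    by (rule continuous_on_compose2[OF holomorphic_on_imp_continuous_on[OF that] continuous_ptv]) (use QB in blast)
  \<comment> \<open>Critical points, where local injectivity fails, are left out. The density
    vanishes at them, so the integral does not change.\<close>
  define G where "G = {v \<in> ?Q. deriv k (ptv v) \<noteq> 0}"
  have G: "open G"
  proof -
    have "G = ?Q \<inter> (\<lambda>v. deriv k (ptv v)) -` (- {0})" by (auto simp: G_def)
    then show ?thesis
      using continuous_open_preimage[OF contQ[OF holo1] open_box, of "- {0}"] by auto
  qed
  \<comment> \<open>The open sets of injectivity cover \<open>G\<close>, and Lindelof's theorem
    reduces them to countably many.\<close>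
  define \<F> where "\<F> = {N. open N \<and> N \<subseteq> ?Q \<and> inj_on chart N}"
  obtain \<F>' where \<F>': "\<F>' \<subseteq> \<F>" "countable \<F>'" "\<Union>\<F>' = \<Union>\<F>"
    using Lindelof[of \<F>] by (auto simp: \<F>_def)
  \<comment> \<open>Inserting \<open>{}\<close> makes the family nonempty, so that it can be
    enumerated by the natural numbers.\<close>
  define N where "N = from_nat_into (insert {} \<F>')"
  have rN: "range N = insert {} \<F>'"
    unfolding N_def using \<F>' by (intro range_from_nat_into) auto
  have N: "open (N i)" "inj_on chart (N i)" for i
  proof -
    have "N i \<in> insert {} \<F>'" using rN by blast
    then have "N i = {} \<or> N i \<in> \<F>" using \<F>'(1) by blast
    then show "open (N i)" "inj_on chart (N i)" by (auto simp: \<F>_def)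
  qed
  have GN: "G \<subseteq> (\<Union>i. N i)"
  proof
    fix v assume "v \<in> G"
    then obtain M where "open M" "v \<in> M" "M \<subseteq> ?Q" "inj_on chart M"
      using chart_locally_inj[of v r] r by (auto simp: G_def)
    then have "v \<in> \<Union>\<F>'" unfolding \<F>'(3) by (auto simp: \<F>_def)
    then show "v \<in> (\<Union>i. N i)" using rN by auto
  qed
  \<comment> \<open>\<open>h\<close> is \<open>Im k\<close> in units of \<open>pi / p\<close>; its
    floor numbers the horizontal strips of that width.\<close>
  define h where "h = (\<lambda>v. Im (k (ptv v)) * p / pi)"
  \<comment> \<open>A cell fixes both a domain of injectivity and the strip, the two indices being
    coded by one natural number. On a cell the reduction is a translation, so derivative and
    injectivity carry over from \<open>chart\<close>.\<close>
  define A where "A = (\<lambda>n. case prod_decode n of (i, j) \<Rightarrow> disjointed N i \<inter> {v \<in> G. \<lfloor>h v\<rfloor> = int_decode j})"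
  have ch: "continuous_on G h"
    unfolding h_def using p
    by (intro continuous_intros continuous_on_subset[OF contQ[OF holo]]) (auto simp: G_def)
  have Gh: "open {v \<in> G. h v < c}" for c
    using continuous_open_preimage[OF ch G, of "{..<c}"] by (simp add: Int_def vimage_def)
  have "{v \<in> G. \<lfloor>h v\<rfloor> = j} = {v \<in> G. h v < of_int j + 1} - {v \<in> G. h v < of_int j}" for j
    by (auto simp: floor_eq_iff)
  then have "{v \<in> G. \<lfloor>h v\<rfloor> = j} \<in> sets borel" for j
    using Gh by simp
  moreover have "disjointed N i \<in> sets borel" for i
  proof -
    have "range N \<subseteq> sets borel" using N by auto
    then show ?thesis using sets.range_disjointed_sets[of N borel] by blast
  qed
  ultimately have "A n \<in> sets borel" for n
    unfolding A_def by (auto split: prod.splits)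
  then have Am: "A n \<in> sets lebesgue" for n
    by (simp add: sets_completionI_sets)
  have Adisj: "disjoint_family A"
    unfolding disjoint_family_on_def
  proof (intro ballI impI)
    fix m n :: nat assume "m \<noteq> n"
    then have *: "prod_decode m \<noteq> prod_decode n"
      by (metis prod_decode_inverse)
    obtain i j i' j' where d: "prod_decode m = (i, j)" "prod_decode n = (i', j')" by fastforce
    show "A m \<inter> A n = {}"
    proof (cases "i = i'")
      case True
      then have "int_decode j \<noteq> int_decode j'" using * d by (metis int_decode_inverse)
      then show ?thesis by (auto simp: A_def d)
    next
      case False
      then show ?thesis
        using disjoint_family_disjointed[of N] by (auto simp: A_def d disjoint_family_on_def)
    qed
  qed
  have UA: "(\<Union>n. A n) = G"
  proof
    show "(\<Union>n. A n) \<subseteq> G" by (auto simp: A_def split: prod.splits)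
    show "G \<subseteq> (\<Union>n. A n)"
    proof
      fix v assume v: "v \<in> G"
      then have "v \<in> (\<Union>i. disjointed N i)" using GN by (auto simp: UN_disjointed_eq)
      then obtain i where "v \<in> disjointed N i" by auto
      then have "v \<in> A (prod_encode (i, int_encode \<lfloor>h v\<rfloor>))" using v by (simp add: A_def)
      then show "v \<in> (\<Union>n. A n)" by blast
    qed
  qed
  \<comment> \<open>Reducing \<open>Im k\<close> modulo \<open>\<pi> / p\<close> makes points with equal image have equal \<open>exp (2 p k)\<close>.\<close>
  define \<Psi> where "\<Psi> = (\<lambda>v. chart v - vector [0, pi / p * \<lfloor>h v\<rfloor>])"
  have \<Psi>: "\<Psi> v $ 1 = tanh (Re (k (ptv v)))" "\<Psi> v $ 2 = pi / p * (h v - \<lfloor>h v\<rfloor>)" for v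
    using p by (simp_all add: \<Psi>_def chart_def h_def right_diff_distrib)
  have \<Psi>A: "\<exists>c. \<forall>v\<in>A n. \<Psi> v = chart v - c" for n
    by (cases "prod_decode n") (auto simp: \<Psi>_def A_def intro!: exI[of _ "vector [0, pi / p * real_of_int (int_decode (snd (prod_decode n)))]"])
  define T where "T = (cbox (vector [-1, 0]) (vector [1, pi / p]) :: (real^2) set)"
  have T: "measure lebesgue T = 2 * pi / p" "T \<in> lmeasurable"
  proof -
    have ne: "(cbox (vector [-1, 0]) (vector [1, pi / p]) :: (real^2) set) \<noteq> {}"
      unfolding interval_ne_empty_cart forall_2 using p by simp
    show "measure lebesgue T = 2 * pi / p"
      unfolding T_def using content_cbox_cart[OF ne] by (simp add: UNIV_2)
    show "T \<in> lmeasurable" unfolding T_def by simp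
  qed
  have Gsub: "G \<subseteq> ?C" using box_subset_cbox by (auto simp: G_def)
  have ccD: "continuous_on ?C ?D"
  proof -
    have "continuous_on ?C (\<lambda>v. (\<lambda>(r, \<theta>). density r \<theta>) (v $ 1, v $ 2))"
      by (rule continuous_on_compose2[OF continuous_density[of UNIV]])
        (use r in \<open>auto intro!: continuous_intros simp: mem_box_cart forall_2\<close>)
    then show ?thesis by simp
  qed
  have Dabs: "?D absolutely_integrable_on ?C"
    by (rule absolutely_integrable_continuous[OF ccD])
  have D0: "\<bar>det (matrix (chart' v))\<bar> = ?D v" if "v \<in> ?Q" for v
    using density_nonneg[of "v $ 1" "v $ 2"] that by (simp add: chart_Jacobian Q)
  have DG: "?D absolutely_integrable_on G"
    by (rule set_integrable_subset[OF Dabs]) (use G Gsub in \<open>auto simp: sets_completionI_sets\<close>)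
  have detG: "(\<lambda>v. \<bar>det (matrix (chart' v))\<bar>) absolutely_integrable_on G"
    using DG by (subst set_integrable_cong[OF refl refl, of _ _ ?D]) (auto simp: D0 G_def)
  have "integral (\<Union>n. A n) (\<lambda>v. \<bar>det (matrix (chart' v))\<bar>) \<le> real p * measure lebesgue T"
  proof (rule integral_Jacobian_le_multiplicity_measure[OF Am Adisj])
    fix n v assume v: "v \<in> A n"
    obtain c where c: "\<And>v. v \<in> A n \<Longrightarrow> \<Psi> v = chart v - c" using \<Psi>A by blast
    have "v \<in> G" using v UA by blast
    then have "\<bar>v $ 1\<bar> < 1" using r by (auto simp: G_def Q)
    then have "((\<lambda>v. chart v - c) has_derivative (\<lambda>x. chart' v x - 0)) (at v within A n)"
      by (intro has_derivative_diff chart_derivative has_derivative_const)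
    then show "(\<Psi> has_derivative chart' v) (at v within A n)"
      by (intro has_derivative_transform[OF v c]) simp_all
  next
    fix n
    obtain c where c: "\<And>v. v \<in> A n \<Longrightarrow> \<Psi> v = chart v - c" using \<Psi>A by blast
    obtain i j where d: "prod_decode n = (i, j)" by fastforce
    have "A n \<subseteq> N i" using disjointed_subset[of N i] by (auto simp: A_def d)
    then have "inj_on chart (A n)" using N(2) inj_on_subset by blast
    then show "inj_on \<Psi> (A n)"
      using c by (auto simp: inj_on_def)
  next
    show "(\<lambda>v. \<bar>det (matrix (chart' v))\<bar>) absolutely_integrable_on (\<Union>i. A i)"
      using detG by (simp add: UA)
    show "\<Psi> ` (\<Union>i. A i) \<subseteq> T"
    proof -
      have "0 \<le> h v - \<lfloor>h v\<rfloor>" "h v - \<lfloor>h v\<rfloor> \<le> 1" for v by linarith+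
      then have "0 \<le> \<Psi> v $ 2 \<and> \<Psi> v $ 2 \<le> pi / p" for v
        unfolding \<Psi> using p mult_left_mono[of "h v - \<lfloor>h v\<rfloor>" 1 "pi / p"] by (auto intro!: mult_nonneg_nonneg)
      moreover have "-1 \<le> \<Psi> v $ 1 \<and> \<Psi> v $ 1 \<le> 1" for v
        unfolding \<Psi> using tanh_real_lt_1 tanh_real_gt_neg1 by (auto intro: less_imp_le)
      ultimately show ?thesis by (auto simp: T_def mem_box_cart forall_2)
    qed
    show "T \<in> lmeasurable" by (fact T)
  next
    fix y
    let ?S = "{v \<in> (\<Union>i. A i). \<Psi> v = y}"
    show "finite ?S \<and> card ?S \<le> p"
    proof (cases "?S = {}")
      case False
      then obtain v0 where v0: "v0 \<in> G" "\<Psi> v0 = y" unfolding UA by blast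
      let ?E = "{x \<in> ball 0 1. exp (2 * of_nat p * k x) = exp (2 * of_nat p * k (ptv v0))}"
      have "ptv ` ?S \<subseteq> ?E"
      proof
        fix x assume "x \<in> ptv ` ?S"
        then obtain v where v: "v \<in> G" "\<Psi> v = \<Psi> v0" "x = ptv v" using v0 unfolding UA by auto
        have re: "Re (k x) = Re (k (ptv v0))"
          using arg_cong[OF v(2), of "\<lambda>z::real^2. z $ 1"] by (simp add: \<Psi> v(3))
        have "h v - \<lfloor>h v\<rfloor> = h v0 - \<lfloor>h v0\<rfloor>"
          using arg_cong[OF v(2), of "\<lambda>z::real^2. z $ 2"] p by (simp add: \<Psi>)
        then have "h v = h v0 + of_int (\<lfloor>h v\<rfloor> - \<lfloor>h v0\<rfloor>)" by simp
        then obtain n :: int where "h v = h v0 + of_int n" by blast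
        \<comment> \<open>An integer difference \<open>n\<close> in \<open>h\<close> is a difference
          \<open>n * pi / p\<close> in \<open>Im k\<close>, hence a full \<open>2 * pi * n\<close>
          in the exponent \<open>2 * p * k\<close>.\<close>
        then have "Im (k x) * p = Im (k (ptv v0)) * p + of_int n * pi"
          unfolding h_def v(3)[symmetric] by (simp add: field_simps)
        then have "2 * of_nat p * k x = 2 * of_nat p * k (ptv v0) + of_real (real_of_int (2 * n) * pi) * \<i>"
          using re by (simp add: complex_eq_iff algebra_simps)
        then have "exp (2 * of_nat p * k x) = exp (2 * of_nat p * k (ptv v0))"
          unfolding exp_eq by blast
        then show "x \<in> ?E" using QB[of v] v by (auto simp: G_def)
      qed
      moreover have "inj_on ptv ?S"
      proof (rule inj_onI)
        fix x y assume "x \<in> ?S" "y \<in> ?S" "ptv x = ptv y"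
        then show "x = y"
          using pt_inj[of "x $ 1" "x $ 2" "y $ 1" "y $ 2"] unfolding UA
          by (auto simp: G_def Q vec_eq_iff forall_2)
      qed
      ultimately show ?thesis
        using val[of "exp (2 * of_nat p * k (ptv v0))"] card_inj_on_le[of ptv ?S ?E]
          inj_on_finite[of ptv ?S ?E] by linarith
    next
      case True
      then show ?thesis unfolding True by simp
    qed
  qed
  also have "real p * measure lebesgue T = 2*pi"
    using p by (simp add: T)
  also have "integral (\<Union>n. A n) (\<lambda>v. \<bar>det (matrix (chart' v))\<bar>) = integral G ?D"
    unfolding UA by (intro integral_cong D0) (auto simp: G_def)
  also have "\<dots> = integral ?Q ?D"
  proof -
    have eq: "(\<lambda>v. if v \<in> G then ?D v else 0) = (\<lambda>v. if v \<in> ?Q then ?D v else 0)"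
      by (auto simp: G_def density_def fun_eq_iff)
    show ?thesis
      unfolding integral_restrict_UNIV[of G ?D, symmetric] integral_restrict_UNIV[of ?Q ?D, symmetric] eq ..
  qed
  also have "\<dots> = integral ?C ?D" by (rule integral_open_interval)
  also have "\<dots> = flux r"
  proof -
    have "continuous_on (cbox (0, 0) (r, 2*pi)) (\<lambda>(r, \<theta>). density r \<theta>)"
      by (rule continuous_on_subset[OF continuous_density[of UNIV]]) (use r in auto)
    from integral_unique[OF integral_cbox_real2[OF this]] show ?thesis
      using r by (simp add: flux_eq_area)
  qed
  finally show ?thesis .
qed
end

section \<open>Distortion of nonvanishing multivalent functions\<close>

context disc_function begin

text \<open>The function \<open>Y\<close> of the proof is nondecreasing by the differential
  inequality. If \<open>|k'(0)|\<close> exceeded 2, it would be larger than 1 by a fixed margin near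
  0, against its upper bound \<open>1 / r\<^sup>2\<close> as \<open>r\<close> approaches 1. The
  number \<open>m\<close> and the radii \<open>\<delta>\<close> and \<open>R\<close> replace both
  limits.\<close>

lemma deriv_le_2_of_flux:
  assumes flux: "\<And>r. 0 < r \<Longrightarrow> r < 1 \<Longrightarrow> flux r \<le> 2*pi" and k0: "Re (k 0) = 0"
  shows "cmod (deriv k 0) \<le> 2"
proof (rule ccontr)
  assume "\<not> ?thesis"
  then have "2 ^ 2 < (cmod (deriv k 0))\<^sup>2" by (intro power_strict_mono) auto
  then obtain m where m: "4 < m" "m < (cmod (deriv k 0))\<^sup>2"
    using dense by auto
  \<comment> \<open>\<open>s\<close> is the area density without the polar factor;
    \<open>Re (k 0) = 0\<close> makes \<open>s 0\<close> equal to
    \<open>|k'(0)|\<^sup>2\<close>.\<close>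
  define s where "s = (\<lambda>x. (1 - (tanh (Re (k x)))\<^sup>2) * (cmod (deriv k x))\<^sup>2)"
  have "continuous_on (ball 0 1) s"
    unfolding s_def using holomorphic_on_imp_continuous_on[OF holo] holomorphic_on_imp_continuous_on[OF holo1]
    by (auto intro!: continuous_intros)
  then have "isCont s 0" by (simp add: continuous_on_eq_continuous_at)
  then have "(s \<longlongrightarrow> s 0) (at 0)" by (simp add: isCont_def)
  moreover have "m < s 0" using m k0 by (simp add: s_def)
  ultimately have "eventually (\<lambda>x. m < s x) (at 0)" by (rule order_tendstoD)
  then obtain e where e: "e > 0" "\<And>x. x \<noteq> 0 \<Longrightarrow> cmod x < e \<Longrightarrow> m < s x"
    by (auto simp: eventually_at)
  define \<delta> where "\<delta> = min (e / 2) (1 / 2)"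
  have \<delta>: "0 < \<delta>" "\<delta> < e" "\<delta> < 1" using e by (auto simp: \<delta>_def)
  have ci: "density r integrable_on {0..2*pi}" if "\<bar>r\<bar> < 1" for r
  proof -
    have "continuous_on {0..2*pi} (\<lambda>\<theta>. (\<lambda>(r, \<theta>). density r \<theta>) (r, \<theta>))"
      by (rule continuous_on_compose2[OF continuous_density[of UNIV]])
         (use that in \<open>auto intro!: continuous_intros\<close>)
    then show ?thesis by (intro integrable_continuous_real) simp
  qed
  have low: "2*pi * (m * r) \<le> integral {0..2*pi} (density r)" if "0 < r" "r \<le> \<delta>" for r
  proof -
    have "r * m \<le> density r \<theta>" for \<theta>
    proof -
      have "m < s (pt r \<theta>)" using that \<delta> by (intro e) (auto simp: pt_def norm_mult)
      then show ?thesis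
        using that unfolding density_def s_def by (intro mult_left_mono) auto
    qed
    then have "integral {0..2*pi} (\<lambda>_. r * m) \<le> integral {0..2*pi} (density r)"
      using that \<delta> by (intro integral_le ci) auto
    then show ?thesis by (simp add: mult_ac)
  qed
  \<comment> \<open>By \<open>low\<close> the area grows at rate at least
    \<open>2 * pi * m * r\<close>, so it stays nondecreasing after \<open>pi * m * r\<^sup>2\<close>
    is subtracted.\<close>
  have "flux 0 - pi * m * 0\<^sup>2 \<le> flux \<delta> - pi * m * \<delta>\<^sup>2"
  proof (rule DERIV_nonneg_imp_increasing_open[of 0 \<delta> "\<lambda>r. flux r - pi * m * r\<^sup>2"])
    fix r assume "0 < r" "r < \<delta>"
    then have "((\<lambda>r. flux r - pi * m * r\<^sup>2) has_real_derivative
        integral {0..2*pi} (density r) - pi * m * (2 * r)) (at r)"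
      using \<delta> by (auto intro!: derivative_eq_intros flux_has_derivative)
    moreover have "0 \<le> integral {0..2*pi} (density r) - pi * m * (2 * r)"
      using low[of r] \<open>0 < r\<close> \<open>r < \<delta>\<close> by (simp add: mult_ac)
    ultimately show "\<exists>y. ((\<lambda>r. flux r - pi * m * r\<^sup>2) has_real_derivative y) (at r) \<and> 0 \<le> y"
      by blast
  qed (use \<delta> in \<open>auto intro!: continuous_intros continuous_flux\<close>)
  then have fl: "pi * m * \<delta>\<^sup>2 \<le> flux \<delta>" by (simp add: flux_0)
  \<comment> \<open>\<open>q\<close> is the midpoint of \<open>4 / m\<close> and 1; a radius
    \<open>R < 1\<close> with \<open>R\<^sup>2 \<ge> q\<close> has \<open>m * R\<^sup>2 > 4\<close>,
    which is the final contradiction.\<close>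
  define q where "q = (4 / m + 1) / 2"
  have q: "4 / m < q" "q < 1" "0 < q" using m by (auto simp: q_def field_simps)
  define R where "R = max ((1 + \<delta>) / 2) (sqrt q)"
  have R: "\<delta> < R" "R < 1" "q \<le> R\<^sup>2"
  proof -
    have "\<delta> < (1 + \<delta>) / 2" using \<delta>(3) by simp
    then show "\<delta> < R" by (simp add: R_def less_max_iff_disj)
    have "sqrt q < 1" using q(2) by simp
    then show "R < 1" using \<delta>(3) unfolding R_def by simp
    have "sqrt q \<le> R" by (simp add: R_def)
    then have "(sqrt q)\<^sup>2 \<le> R\<^sup>2" using q(3) by (intro power_mono) auto
    then show "q \<le> R\<^sup>2" using q(3) by simp
  qed
  define Y where "Y = (\<lambda>r. flux r / (4*pi - flux r) / r\<^sup>2)"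
  have pos: "4*pi - flux r > 0" if "0 < r" "r < 1" for r
    using flux[OF that] pi_gt_zero by linarith
  have "Y \<delta> \<le> Y R"
  proof (rule DERIV_nonneg_imp_nondecreasing[of \<delta> R Y])
    fix r assume "\<delta> \<le> r" "r \<le> R"
    then have r: "0 < r" "r < 1" using \<delta> R by auto
    let ?N = "integral {0..2*pi} (density r)"
    have "(Y has_real_derivative
      ((?N * (4*pi - flux r) - flux r * (0 - ?N)) / ((4*pi - flux r) * (4*pi - flux r)) * r\<^sup>2
         - flux r / (4*pi - flux r) * (2 * r)) / (r\<^sup>2 * r\<^sup>2)) (at r)"
      unfolding Y_def using pos[OF r] r
      by (intro DERIV_divide flux_has_derivative DERIV_diff DERIV_const) (auto intro!: derivative_eq_intros)
    \<comment> \<open>Because \<open>flux r\<close> and \<open>4*pi - flux r\<close> add up to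
      \<open>4*pi\<close>, the derivative is a positive multiple of the isoperimetric
      deficit.\<close>
    moreover have "((?N * (4*pi - flux r) - flux r * (0 - ?N)) / ((4*pi - flux r) * (4*pi - flux r)) * r\<^sup>2
         - flux r / (4*pi - flux r) * (2 * r)) / (r\<^sup>2 * r\<^sup>2)
      = 2 * (2*pi * r * ?N - flux r * (4*pi - flux r)) * r / ((4*pi - flux r) * (4*pi - flux r)) / (r\<^sup>2 * r\<^sup>2)"
    proof -
      have "(a * d - f * (0 - a)) / (d * d) * r\<^sup>2 - f / d * (2 * r) = 2 * ((d + f) / 2 * r * a - f * d) * r / (d * d)"
        if "d \<noteq> 0" for a d f :: real
        using that by (simp add: field_simps power2_eq_square)
      from this[of "4*pi - flux r" ?N "flux r"] show ?thesis using pos[OF r] by simp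
    qed
    moreover have "0 \<le> 2 * (2*pi * r * ?N - flux r * (4*pi - flux r)) * r / ((4*pi - flux r) * (4*pi - flux r)) / (r\<^sup>2 * r\<^sup>2)"
      using flux_differential_inequality[OF r] r less_imp_le[OF pos[OF r]]
      by (intro divide_nonneg_nonneg mult_nonneg_nonneg) auto
    ultimately show "\<exists>y. (Y has_real_derivative y) (at r) \<and> 0 \<le> y" by metis
  qed (use R in auto)
  moreover have "m / 4 \<le> Y \<delta>"
  proof -
    have f0: "0 \<le> flux \<delta>" using fl m by (meson mult_nonneg_nonneg order_trans pi_ge_zero zero_le_power2 less_imp_le zero_less_numeral)
    have "m / 4 * \<delta>\<^sup>2 * (4*pi - flux \<delta>) \<le> m / 4 * \<delta>\<^sup>2 * (4*pi)"
      using f0 m by (intro mult_left_mono) auto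
    also have "\<dots> \<le> flux \<delta>" using fl by (simp add: mult_ac)
    finally show ?thesis
      unfolding Y_def using pos[of \<delta>] \<delta> by (simp add: pos_le_divide_eq mult_ac)
  qed
  moreover have "Y R \<le> 1 / R\<^sup>2"
  proof -
    have "0 < R" using R \<delta> by simp
    then have "flux R / (4*pi - flux R) \<le> 1"
      using flux[of R] pos[of R] R by (simp add: divide_le_eq)
    then show ?thesis unfolding Y_def by (intro divide_right_mono) auto
  qed
  ultimately have "m / 4 \<le> 1 / R\<^sup>2" by linarith
  then have "m * R\<^sup>2 \<le> 4" using R \<delta> by (simp add: field_simps)
  moreover have "4 < m * q" using q m by (simp add: field_simps)
  moreover have "m * q \<le> m * R\<^sup>2" using R m by (intro mult_left_mono) auto
  ultimately show False by linarith
qed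
end

section \<open>From the origin to the whole disc\<close>

definition valent_in_disc :: "nat \<Rightarrow> (complex \<Rightarrow> complex) \<Rightarrow> bool" where
  "valent_in_disc p g \<longleftrightarrow> (\<forall>w. finite {x \<in> ball 0 1. g x = w} \<and> card {x \<in> ball 0 1. g x = w} \<le> p)"

text \<open>Subtracting \<open>k 0\<close> normalises the real part at 0. It only divides the
  exponential by a nonzero constant, which preserves the valence.\<close>

lemma deriv_le_2_at_0:
  assumes kholo: "k holomorphic_on ball 0 1" and p: "p \<ge> 1"
    and val: "valent_in_disc p (\<lambda>x. exp (2 * of_nat p * k x))"
  shows "cmod (deriv k 0) \<le> 2"
proof -
  define k1 where "k1 = (\<lambda>x. k x - k 0)"
  interpret disc_function k1
    unfolding k1_def by unfold_locales (intro holomorphic_intros kholo)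
  have "cmod (deriv k1 0) \<le> 2"
  proof (rule deriv_le_2_of_flux)
    fix r :: real assume r: "0 < r" "r < 1"
    show "flux r \<le> 2*pi"
    proof (rule area_le_multiplicity[OF p _ r])
      fix w
      have "exp (2 * of_nat p * k1 x) = w \<longleftrightarrow> exp (2 * of_nat p * k x) = w * exp (2 * of_nat p * k 0)" for x
        by (simp add: k1_def right_diff_distrib exp_diff divide_eq_eq)
      then show "finite {x \<in> ball 0 1. exp (2 * of_nat p * k1 x) = w} \<and>
          card {x \<in> ball 0 1. exp (2 * of_nat p * k1 x) = w} \<le> p"
        using val by (simp add: valent_in_disc_def)
    qed
  qed (simp add: k1_def)
  moreover have "deriv k1 0 = deriv k 0"
  proof -
    have "(k has_field_derivative deriv k 0) (at 0)"
      using kholo by (intro holomorphic_derivI[of _ "ball 0 1"]) auto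
    then have "(k1 has_field_derivative deriv k 0) (at 0)"
      unfolding k1_def by (auto intro!: derivative_eq_intros)
    then show ?thesis by (rule DERIV_imp_deriv)
  qed
  ultimately show ?thesis by simp
qed

text \<open>Composition with the disc automorphism \<open>\<mu>\<close> that takes 0 to
  \<open>a\<close> preserves the valence and moves the bound from 0 to \<open>a\<close>;
  \<open>\<mu>\<close> has derivative \<open>1 - |a|\<^sup>2\<close> at 0.\<close>

lemma deriv_le_hyperbolic:
  assumes holo: "k holomorphic_on ball 0 1" and p: "p \<ge> 1"
    and val: "valent_in_disc p (\<lambda>x. exp (2 * of_nat p * k x))" and a: "cmod a < 1"
  shows "cmod (deriv k a) \<le> 2 / (1 - (cmod a)\<^sup>2)"
proof -
  define \<mu> where "\<mu> = Moebius_function 0 (- a)"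
  have na: "cmod (- a) < 1" using a by simp
  have \<mu>h: "\<mu> holomorphic_on ball 0 1"
    unfolding \<mu>_def by (rule Moebius_function_holomorphic[OF na])
  have \<mu>b: "\<mu> x \<in> ball 0 1" if "x \<in> ball 0 1" for x
    unfolding \<mu>_def using Moebius_function_norm_lt_1[OF na] that by simp
  have \<mu>i: "Moebius_function 0 a (\<mu> x) = x" if "x \<in> ball 0 1" for x
    unfolding \<mu>_def using Moebius_function_compose[of "a" "- a" x] a that by simp
  have \<mu>0: "\<mu> 0 = a" by (simp add: \<mu>_def Moebius_function_def)
  have inj: "inj_on \<mu> (ball 0 1)" using \<mu>i by (metis inj_onI)
  have \<mu>d: "(\<mu> has_field_derivative 1 - (cmod a)\<^sup>2) (at 0)"
    unfolding \<mu>_def Moebius_function_def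
    by (auto intro!: derivative_eq_intros simp flip: complex_norm_square)
  have kd: "(k has_field_derivative deriv k a) (at a)"
    using holo a by (intro holomorphic_derivI[of _ "ball 0 1"]) auto
  have "((\<lambda>x. k (\<mu> x)) has_field_derivative deriv k a * of_real (1 - (cmod a)\<^sup>2)) (at 0)"
    using DERIV_chain2[OF kd[folded \<mu>0] \<mu>d] by (simp add: \<mu>0)
  then have "deriv (\<lambda>x. k (\<mu> x)) 0 = deriv k a * of_real (1 - (cmod a)\<^sup>2)"
    by (rule DERIV_imp_deriv)
  moreover have "cmod (deriv (\<lambda>x. k (\<mu> x)) 0) \<le> 2"
  proof (rule deriv_le_2_at_0[OF _ p])
    show "(\<lambda>x. k (\<mu> x)) holomorphic_on ball 0 1"
    proof -
      have "\<mu> ` ball 0 1 \<subseteq> ball 0 1" using \<mu>b by blast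
      from holomorphic_on_compose_gen[OF \<mu>h holo this] show ?thesis by (simp add: o_def)
    qed
    show "valent_in_disc p (\<lambda>x. exp (2 * of_nat p * k (\<mu> x)))"
      unfolding valent_in_disc_def
    proof
      fix w
      let ?S = "{x \<in> ball 0 1. exp (2 * of_nat p * k (\<mu> x)) = w}"
      let ?T = "{x \<in> ball 0 1. exp (2 * of_nat p * k x) = w}"
      have "inj_on \<mu> ?S" using inj by (rule inj_on_subset) auto
      moreover have "\<mu> ` ?S \<subseteq> ?T" using \<mu>b by auto
      ultimately show "finite ?S \<and> card ?S \<le> p"
        using val card_inj_on_le[of \<mu> ?S ?T] inj_on_finite[of \<mu> ?S ?T]
        unfolding valent_in_disc_def by (meson order_trans)
    qed
  qed
  moreover have "0 < 1 - (cmod a)\<^sup>2" using a by (simp add: abs_square_less_1)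
  ultimately show ?thesis
    unfolding norm_mult norm_of_real by (simp only: norm_mult norm_of_real abs_of_pos pos_le_divide_eq)
qed

text \<open>The derivative bound is integrated along the radius from 0 to \<open>x\<close>. The
  right-hand side is the hyperbolic distance for the metric
  \<open>2 |dx| / (1 - |x|\<^sup>2)\<close>.\<close>

lemma hyperbolic_distance_bound:
  assumes holo: "k holomorphic_on ball 0 1" and p: "p \<ge> 1"
    and val: "valent_in_disc p (\<lambda>x. exp (2 * of_nat p * k x))" and x: "cmod x < 1"
  shows "cmod (k x - k 0) \<le> ln ((1 + cmod x) / (1 - cmod x))"
proof -
  define r where "r = cmod x"
  have r: "0 \<le> r" "r < 1" using x by (auto simp: r_def)
  have sr: "0 \<le> s * r" "s * r < 1" if "0 \<le> s" "s \<le> 1" for s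
    using that r mult_le_one[of s r] mult_left_le_one_le[of r s] by (auto simp: mult.commute)
  define \<phi> where "\<phi> = (\<lambda>s. ln (1 + s * r) - ln (1 - s * r))"
  have inb: "of_real s * x \<in> ball 0 1" if "0 \<le> s" "s \<le> 1" for s :: real
    using sr[OF that] that by (simp add: norm_mult r_def)
  have "cmod (k (of_real 1 * x) - k (of_real 0 * x)) \<le> \<phi> 1 - \<phi> 0"
  proof (rule differentiable_bound_general[of 0 1 "\<lambda>s. k (of_real s * x)" \<phi>
        "\<lambda>s. x * deriv k (of_real s * x)" "\<lambda>s. 2 * r / (1 - (s * r)\<^sup>2)"])
    show "continuous_on {0..1} (\<lambda>s. k (of_real s * x))"
      by (rule continuous_on_compose2[OF holomorphic_on_imp_continuous_on[OF holo]])
         (use inb in \<open>auto intro!: continuous_intros\<close>)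
    show "continuous_on {0..1} \<phi>"
      unfolding \<phi>_def
      by (intro continuous_intros) (use sr in \<open>fastforce simp: add_eq_0_iff\<close>)+
  next
    fix s :: real assume s: "0 < s" "s < 1"
    have "((\<lambda>s. of_real s * x) has_vector_derivative x) (at s)"
      by (auto intro!: derivative_eq_intros simp: has_vector_derivative_def scaleR_conv_of_real)
    moreover have "(k has_field_derivative deriv k (of_real s * x)) (at (of_real s * x))"
      using holo inb[of s] s by (intro holomorphic_derivI[of _ "ball 0 1"]) auto
    ultimately show "((\<lambda>s. k (of_real s * x)) has_vector_derivative x * deriv k (of_real s * x)) (at s)"
      using field_vector_diff_chain_at[of "\<lambda>s. of_real s * x" x s k] by (simp add: o_def)
    have "(\<phi> has_real_derivative r / (1 + s * r) - (- r) / (1 - s * r)) (at s)"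
      unfolding \<phi>_def using sr[of s] s by (auto intro!: derivative_eq_intros)
    also have "r / (1 + s * r) - (- r) / (1 - s * r) = 2 * r / (1 - (s * r)\<^sup>2)"
    proof -
      have "r / (1 + y) - (- r) / (1 - y) = 2 * r / (1 - y\<^sup>2)" if "0 \<le> y" "y < 1" for y
      proof -
        have "1 - y\<^sup>2 = (1 + y) * (1 - y)" by (simp add: power2_eq_square algebra_simps)
        then show ?thesis using that by (simp add: field_simps)
      qed
      then show ?thesis using sr[of s] s by simp
    qed
    finally show "(\<phi> has_vector_derivative 2 * r / (1 - (s * r)\<^sup>2)) (at s)"
      by (simp add: has_real_derivative_iff_has_vector_derivative)
    have "cmod (deriv k (of_real s * x)) \<le> 2 / (1 - (cmod (of_real s * x))\<^sup>2)"
      using inb[of s] s by (intro deriv_le_hyperbolic[OF holo p val]) auto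
    then have "r * cmod (deriv k (of_real s * x)) \<le> r * (2 / (1 - (s * r)\<^sup>2))"
      using s r by (intro mult_left_mono) (auto simp: norm_mult r_def)
    then show "cmod (x * deriv k (of_real s * x)) \<le> 2 * r / (1 - (s * r)\<^sup>2)"
      by (simp add: norm_mult r_def mult.commute)
  qed simp
  also have "\<phi> 1 - \<phi> 0 = ln ((1 + r) / (1 - r))"
    using r by (simp add: \<phi>_def ln_div)
  finally show ?thesis by (simp add: r_def)
qed

text \<open>With \<open>g = exp (2 p k)\<close>, the path from \<open>z\<close> to \<open>x\<close>
  through 0 adds two hyperbolic distances, so their exponentials multiply. The exponent
  \<open>2 * p\<close> accounts for the square in \<open>sigma_factor\<close> and its power
  \<open>p\<close>.\<close>

lemma nonvanishing_valent_distortion: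
  assumes holo: "g holomorphic_on ball 0 1" and nz: "\<And>x. x \<in> ball 0 1 \<Longrightarrow> g x \<noteq> 0"
    and val: "valent_in_disc p g" and x: "cmod x < 1" and z: "cmod z < 1"
  shows "cmod (g x) \<le> sigma_factor (cmod z) (cmod x) ^ p * cmod (g z)"
proof -
  \<comment> \<open>The value \<open>g 0\<close> is attained, so the valence bound is at least
    1.\<close>
  have p: "p \<ge> 1"
  proof -
    have "finite {x \<in> ball 0 1. g x = g 0}" "card {x \<in> ball 0 1. g x = g 0} \<le> p"
      using val by (auto simp: valent_in_disc_def)
    moreover have "0 \<in> {x \<in> ball 0 1. g x = g 0}" by simp
    ultimately show ?thesis by (metis One_nat_def Suc_leI card_gt_0_iff empty_iff order_less_le_trans)
  qed
  obtain h where h: "h holomorphic_on ball 0 1" "\<And>x. x \<in> ball 0 1 \<Longrightarrow> exp (h x) = g x"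
    using holomorphic_logarithm_exists[OF convex_ball open_ball holo nz, of 0] by auto
  define k where "k = (\<lambda>x. h x / (2 * of_nat p))"
  have kh: "k holomorphic_on ball 0 1"
    unfolding k_def using p by (intro holomorphic_intros h) auto
  have gk: "g x = exp (2 * of_nat p * k x)" if "x \<in> ball 0 1" for x
    using h(2)[OF that] p by (simp add: k_def)
  have kval: "valent_in_disc p (\<lambda>x. exp (2 * of_nat p * k x))"
  proof -
    have "{x \<in> ball 0 1. exp (2 * of_nat p * k x) = w} = {x \<in> ball 0 1. g x = w}" for w
      using gk by auto
    then show ?thesis using val unfolding valent_in_disc_def by simp
  qed
  have g: "cmod (g x) = exp (2 * real p * Re (k x))" if "cmod x < 1" for x
    using gk[of x] that by simp
  define L where "L = (\<lambda>x. ln ((1 + cmod x) / (1 - cmod x)))"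
  have "Re (k x) - Re (k z) = Re (k x - k 0) - Re (k z - k 0)" by simp
  also have "\<dots> \<le> L x + L z"
    using hyperbolic_distance_bound[OF kh p kval x] hyperbolic_distance_bound[OF kh p kval z]
      abs_Re_le_cmod[of "k x - k 0"] abs_Re_le_cmod[of "k z - k 0"] unfolding L_def by linarith
  finally have "2 * real p * Re (k x) \<le> 2 * real p * (L x + L z) + 2 * real p * Re (k z)"
    using p by (simp flip: distrib_left)
  then have "cmod (g x) \<le> exp (2 * real p * (L x + L z)) * cmod (g z)"
    unfolding g[OF x] g[OF z] exp_add[symmetric] by simp
  also have "exp (2 * real p * (L x + L z)) = (exp (L x) * exp (L z)) ^ (2 * p)"
    by (simp add: exp_add[symmetric] exp_of_nat_mult[symmetric])
  also have "exp (L x) = (1 + cmod x) / (1 - cmod x)"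
    unfolding L_def using x by (intro exp_ln) (auto intro!: divide_pos_pos add_pos_nonneg)
  also have "exp (L z) = (1 + cmod z) / (1 - cmod z)"
    unfolding L_def using z by (intro exp_ln) (auto intro!: divide_pos_pos add_pos_nonneg)
  finally show ?thesis
    unfolding sigma_factor_def power_mult times_divide_times_eq by (simp only: mult.commute)
qed

section \<open>The Remez-type inequality\<close>

text \<open>Away from the zeros the cofactor is the quotient of \<open>f\<close> by the product. At
  a zero it is the local cofactor \<open>zor_poly\<close> divided by the factors of the other
  zeros.\<close>

lemma factor_out_zeros:
  assumes f: "f holomorphic_on S" and S: "open S" "connected S" "S \<noteq> {}"
    and fin: "finite {z \<in> S. f z = 0}"
  obtains g where "g holomorphic_on S" "\<And>x. x \<in> S \<Longrightarrow> g x \<noteq> 0"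
    "\<And>x. x \<in> S \<Longrightarrow> f x = (\<Prod>z\<in>{z \<in> S. f z = 0}. (x - z) ^ nat (zorder f z)) * g x"
    "\<And>z. z \<in> S \<Longrightarrow> f z = 0 \<Longrightarrow> zorder f z > 0"
proof -
  define A where "A = {z \<in> S. f z = 0}"
  define n where "n = (\<lambda>z. nat (zorder f z))"
  define P where "P = (\<lambda>B x. \<Prod>z\<in>B. (x - z) ^ n z)"
  define g where "g = (\<lambda>x. if x \<in> A then zor_poly f x x / P (A - {x}) x else f x / P A x)"
  have finA: "finite A" using fin by (simp add: A_def)
  \<comment> \<open>A nonempty open set is infinite, so its finitely many zeros cannot exhaust
    \<open>S\<close>; this gives the point with \<open>f w \<noteq> 0\<close> that the local
    factorisation requires.\<close>
  have "\<not> finite S" using S finite_imp_not_open by blast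
  then have "S \<noteq> A" using finA by blast
  then have nc: "\<exists>w\<in>S. f w \<noteq> 0" by (auto simp: A_def)
  have P0: "P B x \<noteq> 0" if "x \<notin> B" "finite B" for B x
    using that by (auto simp: P_def)
  have Ph: "P B holomorphic_on U" for B U
    unfolding P_def by (intro holomorphic_intros)
  have loc: "zorder f w > 0 \<and> g w \<noteq> 0 \<and> f w = P A w * g w \<and>
      (\<exists>U q. open U \<and> w \<in> U \<and> q holomorphic_on U \<and> (\<forall>x\<in>U. q x = g x))" if w: "w \<in> A" for w
  proof -
    have "w \<in> S" "f w = 0" using w by (auto simp: A_def)
    then obtain r where zo: "zorder f w > 0" and r: "r > 0" "cball w r \<subseteq> S"
      "zor_poly f w holomorphic_on cball w r"
      and fac: "\<And>x. x \<in> cball w r \<Longrightarrow> f x = zor_poly f w x * (x - w) ^ n w"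
      and nz: "\<And>x. x \<in> cball w r \<Longrightarrow> zor_poly f w x \<noteq> 0"
      using zorder_exist_zero[OF f S(1,2) _ nc, of w] unfolding n_def by (auto split: if_splits)
    \<comment> \<open>With the other zeros removed from the ball, one quotient formula represents
      \<open>g\<close> on all of \<open>U\<close>, including \<open>w\<close>.\<close>
    define U where "U = ball w r - (A - {w})"
    have PA: "P A x = (x - w) ^ n w * P (A - {w}) x" for x
      unfolding P_def using w finA by (subst prod.remove[of A w]) auto
    have "open U"
      unfolding U_def using finA by (intro open_Diff open_ball finite_imp_closed) auto
    moreover have "w \<in> U" using r by (simp add: U_def)
    moreover have "(\<lambda>x. zor_poly f w x / P (A - {w}) x) holomorphic_on U"
    proof (intro holomorphic_intros Ph)
      show "zor_poly f w holomorphic_on U"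
        using r(3) by (rule holomorphic_on_subset) (auto simp: U_def)
    qed (use P0 finA in \<open>auto simp: U_def\<close>)
    moreover have "zor_poly f w x / P (A - {w}) x = g x" if "x \<in> U" for x
    proof (cases "x = w")
      case True
      then show ?thesis using w by (simp add: g_def)
    next
      case False
      then have "x \<notin> A" "x \<in> cball w r" using that by (auto simp: U_def)
      then show ?thesis using False by (simp add: g_def PA fac)
    qed
    ultimately have "\<exists>U q. open U \<and> w \<in> U \<and> q holomorphic_on U \<and> (\<forall>x\<in>U. q x = g x)" by blast
    moreover have "g w \<noteq> 0" using w r nz[of w] P0[of w "A - {w}"] finA by (simp add: g_def)
    moreover have "P A w = 0" using PA[of w] zo by (simp add: n_def)
    ultimately show ?thesis using zo \<open>f w = 0\<close> by simp
  qed
  show ?thesis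
  proof (rule that[of g])
    show "g holomorphic_on S"
      unfolding holomorphic_on_open[OF S(1)]
    proof
      fix w assume w: "w \<in> S"
      have "\<exists>U q. open U \<and> w \<in> U \<and> q holomorphic_on U \<and> (\<forall>x\<in>U. q x = g x)"
      proof (cases "w \<in> A")
        case True
        then show ?thesis using loc by blast
      next
        case False
        have "(\<lambda>x. f x / P A x) holomorphic_on S - A"
          by (intro holomorphic_intros Ph holomorphic_on_subset[OF f]) (use P0 finA in auto)
        moreover have "open (S - A)" using S finA by (intro open_Diff finite_imp_closed)
        moreover have "\<forall>x\<in>S - A. f x / P A x = g x" by (simp add: g_def)
        ultimately show ?thesis using w False by blast
      qed
      then obtain U q where U: "open U" "w \<in> U" "q holomorphic_on U" "\<And>x. x \<in> U \<Longrightarrow> q x = g x" by blast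
      have "(q has_field_derivative deriv q w) (at w)"
        by (rule holomorphic_derivI[OF U(3,1,2)])
      from has_field_derivative_transform_within_open[OF this U(1,2) U(4)]
      show "\<exists>g'. (g has_field_derivative g') (at w)" ..
    qed
    show "g x \<noteq> 0" if "x \<in> S" for x
    proof (cases "x \<in> A")
      case True
      then show ?thesis using loc by blast
    next
      case False
      then have "f x \<noteq> 0" using that by (simp add: A_def)
      then show ?thesis using P0[OF False finA] False by (simp add: g_def)
    qed
    show "f x = (\<Prod>z\<in>{z \<in> S. f z = 0}. (x - z) ^ nat (zorder f z)) * g x" if "x \<in> S" for x
    proof -
      have "f x = P A x * g x"
      proof (cases "x \<in> A")
        case True
        then show ?thesis using loc by blast
      next
        case False
        then show ?thesis using P0[OF False finA] by (simp add: g_def)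
      qed
      then show ?thesis by (simp add: P_def A_def n_def)
    qed
    show "zorder f z > 0" if "z \<in> S" "f z = 0" for z
    proof -
      have "z \<in> A" using that by (simp add: A_def)
      then show ?thesis using loc by blast
    qed
  qed
qed

lemma sigma_factor_mono:
  assumes "0 \<le> a" "a \<le> R" "R < 1" "0 \<le> b" "b \<le> R'" "R' < 1"
  shows "sigma_factor a b \<le> sigma_factor R R'"
proof -
  have *: "(1 + u) / (1 - u) \<le> (1 + v) / (1 - v)" if "0 \<le> u" "u \<le> v" "v < 1" for u v :: real
    using that by (intro frac_le) auto
  have "((1 + a) / (1 - a)) * ((1 + b) / (1 - b)) \<le> ((1 + R) / (1 - R)) * ((1 + R') / (1 - R'))"
    using assms by (intro mult_mono *) auto
  then show ?thesis
    unfolding sigma_factor_def using assms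
    by (intro power_mono) (auto simp: times_divide_times_eq)
qed

theorem theorem4p1:
  fixes s p :: nat and f :: "complex \<Rightarrow> complex" and Z :: "complex set" and R R' c :: real
  assumes "s \<ge> 1"
    and "f holomorphic_on ball 0 1"
    and "has_exactly_zeros f (ball 0 1) s"
    and "sp_valent s p f (ball 0 1)"
    and "0 \<le> R" and "R < 1"
    and "Z \<subseteq> cball 0 R"
    and "cover_radius s Z = c" and "c > 0"
    and "0 \<le> R'" and "R' < 1"
  shows "(SUP x\<in>cball 0 R'. cmod (f x)) \<le>
           sigma_factor R R' ^ p * (6 * exp 1 / c) ^ s * (SUP x\<in>Z. cmod (f x))"
proof -
  define A where "A = {z \<in> ball 0 1. f z = 0}"
  define n where "n = (\<lambda>z. nat (zorder f z))"
  define P where "P = (\<lambda>x. \<Prod>z\<in>A. (x - z) ^ n z)"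
  have finA: "finite A" and sum: "(\<Sum>z\<in>A. zorder f z) = int s"
    using assms(3) by (auto simp: has_exactly_zeros_def A_def)
  obtain g where g: "g holomorphic_on ball 0 1" "\<And>x. x \<in> ball 0 1 \<Longrightarrow> g x \<noteq> 0"
    and fP: "\<And>x. x \<in> ball 0 1 \<Longrightarrow> f x = P x * g x"
    and zo: "\<And>z. z \<in> A \<Longrightarrow> zorder f z > 0"
  proof (rule factor_out_zeros[OF assms(2) open_ball connected_ball])
    show "ball 0 1 \<noteq> ({} :: complex set)" by simp
    show "finite {z \<in> ball 0 1. f z = 0}" using finA by (simp add: A_def)
  qed (rule that, auto simp: A_def P_def n_def)
  have sumn: "(\<Sum>z\<in>A. n z) = s"
  proof -
    have "int (\<Sum>z\<in>A. n z) = (\<Sum>z\<in>A. zorder f z)"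
      unfolding of_nat_sum by (intro sum.cong) (auto simp: n_def dest: zo)
    then have "int (\<Sum>z\<in>A. n z) = int s" using sum by (rule trans)
    then show ?thesis by (simp only: of_nat_eq_iff)
  qed
  \<comment> \<open>Each zero is repeated according to its multiplicity, so that
    \<open>|P x|\<close> becomes a product of exactly \<open>s\<close> distances.\<close>
  define I where "I = Sigma A (\<lambda>z. {..<n z})"
  have finI: "finite I" and cI: "card I = s"
    using finA sumn by (simp_all add: I_def)
  have normP: "cmod (P x) = (\<Prod>i\<in>I. dist x (fst i))" for x
  proof -
    have "cmod (P x) = (\<Prod>z\<in>A. \<Prod>j<n z. dist x z)"
      by (simp add: P_def dist_norm norm_power flip: prod_norm)
    also have "\<dots> = (\<Prod>i\<in>I. dist x (fst i))"
      unfolding I_def using finA by (subst prod.Sigma) (auto simp: case_prod_beta')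
    finally show ?thesis .
  qed
  have val: "valent_in_disc p g"
    unfolding valent_in_disc_def
  proof
    fix w
    \<comment> \<open>The comparison polynomial is \<open>w * P\<close>: where \<open>g\<close>
      equals \<open>w\<close>, \<open>f = P * g\<close> equals it. Zeros of \<open>P\<close> may be
      further solutions, but an inclusion of the solution sets suffices.\<close>
    define Q where "Q = smult w (\<Prod>z\<in>A. [:- z, 1:] ^ n z)"
    have "degree (\<Prod>z\<in>A. [:- z, 1:] ^ n z) \<le> (\<Sum>z\<in>A. n z)"
      using degree_prod_sum_le[OF finA, of "\<lambda>z. [:- z, 1:] ^ n z"] by (simp add: o_def degree_linear_power)
    then have degQ: "degree Q \<le> s"
      unfolding Q_def using degree_smult_le[of w] sumn by (blast intro: order_trans)
    have sub: "{x \<in> ball 0 1. g x = w} \<subseteq> {x \<in> ball 0 1. f x = poly Q x}"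
      by (auto simp: fP Q_def poly_prod P_def)
    show "finite {x \<in> ball 0 1. g x = w} \<and> card {x \<in> ball 0 1. g x = w} \<le> p"
    proof -
      have "finite {x \<in> ball 0 1. f x = poly Q x} \<and> card {x \<in> ball 0 1. f x = poly Q x} \<le> p"
        using assms(4) degQ unfolding sp_valent_def by blast
      then show ?thesis
        using sub finite_subset[OF sub] card_mono[OF _ sub] by (auto intro: order_trans)
    qed
  qed
  obtain z where z: "z \<in> Z" "(c / (3 * exp 1)) ^ s \<le> cmod (P z)"
  proof -
    have "I \<noteq> {}" using cI assms(1) by auto
    from exists_point_prod_dist_ge[OF finI this, of Z c fst, unfolded cI, OF assms(8,9)] show ?thesis
      using that unfolding normP by blast
  qed
  have zR: "cmod z \<le> R" using z assms(7) by auto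
  have zb: "z \<in> ball 0 1" using zR assms by simp
  \<comment> \<open>Boundedness makes the supremum over \<open>Z\<close> a true upper bound; it
    comes from the compact disc containing \<open>Z\<close>.\<close>
  have bdd: "bdd_above ((\<lambda>x. cmod (f x)) ` Z)"
  proof -
    have "continuous_on (cball 0 R) (\<lambda>x. cmod (f x))"
      using assms by (intro continuous_intros continuous_on_subset[OF holomorphic_on_imp_continuous_on[OF assms(2)]]) auto
    then have "compact ((\<lambda>x. cmod (f x)) ` cball 0 R)"
      by (rule compact_continuous_image) simp
    then have "bdd_above ((\<lambda>x. cmod (f x)) ` cball 0 R)"
      by (intro bounded_imp_bdd_above compact_imp_bounded)
    then show ?thesis by (rule bdd_above_mono) (use assms(7) in auto)
  qed
  show ?thesis
  proof (rule cSUP_least)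
    show "cball 0 R' \<noteq> ({} :: complex set)" using assms by simp
    fix x :: complex assume "x \<in> cball 0 R'"
    then have xR: "cmod x \<le> R'" by simp
    then have xb: "x \<in> ball 0 1" using assms by simp
    \<comment> \<open>Both \<open>x\<close> and the zeros lie in the unit disc, so each distance is
      at most 2; together with the 3 from Cartan's lemma this produces the 6.\<close>
    have "cmod (P x) \<le> (\<Prod>i\<in>I. 2)"
      unfolding normP
    proof (intro prod_mono conjI)
      fix i assume "i \<in> I"
      then have "cmod (fst i) < 1" by (auto simp: I_def A_def)
      then show "dist x (fst i) \<le> 2"
        using norm_triangle_ineq4[of x "fst i"] xb by (simp add: dist_norm)
    qed simp
    then have Px: "cmod (P x) \<le> 2 ^ s" by (simp add: cI)
    have "cmod (g x) \<le> sigma_factor (cmod z) (cmod x) ^ p * cmod (g z)"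
      using xb zb by (intro nonvanishing_valent_distortion g val) auto
    also have "\<dots> \<le> sigma_factor R R' ^ p * cmod (g z)"
      using xR zR assms by (intro mult_right_mono power_mono sigma_factor_mono) (auto simp: sigma_factor_def)
    finally have gx: "cmod (g x) \<le> sigma_factor R R' ^ p * cmod (g z)" .
    have c3: "0 < c / (3 * exp 1)" using assms by simp
    have "(c / (3 * exp 1)) ^ s * cmod (g z) \<le> cmod (P z) * cmod (g z)"
      using z by (intro mult_right_mono) auto
    also have "\<dots> = cmod (f z)" using fP[OF zb] by (simp add: norm_mult)
    finally have "cmod (g z) \<le> cmod (f z) / (c / (3 * exp 1)) ^ s"
      using zero_less_power[OF c3, of s] by (simp only: pos_le_divide_eq mult.commute)
    also have "\<dots> = (3 * exp 1 / c) ^ s * cmod (f z)"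
      by (simp add: power_divide)
    finally have gz: "cmod (g z) \<le> (3 * exp 1 / c) ^ s * cmod (f z)" .
    have sg: "0 \<le> sigma_factor R R' ^ p" by (simp add: sigma_factor_def)
    have "cmod (f x) = cmod (P x) * cmod (g x)" using fP[OF xb] by (simp add: norm_mult)
    also have "\<dots> \<le> 2 ^ s * (sigma_factor R R' ^ p * ((3 * exp 1 / c) ^ s * cmod (f z)))"
      using gx gz sg by (intro mult_mono Px order_trans[OF gx] mult_left_mono[OF gz]) auto
    also have "\<dots> = sigma_factor R R' ^ p * (6 * exp 1 / c) ^ s * cmod (f z)"
    proof -
      have e: "2 ^ s * (3 * exp 1 / c) ^ s = (6 * exp 1 / c) ^ s"
        unfolding power_mult_distrib[symmetric] by simp
      show ?thesis unfolding e[symmetric] by (simp only: mult_ac)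
    qed
    also have "\<dots> \<le> sigma_factor R R' ^ p * (6 * exp 1 / c) ^ s * (SUP x\<in>Z. cmod (f x))"
      using sg assms by (intro mult_left_mono cSUP_upper z bdd mult_nonneg_nonneg) auto
    finally show "cmod (f x) \<le> sigma_factor R R' ^ p * (6 * exp 1 / c) ^ s * (SUP x\<in>Z. cmod (f x))" .
  qed
qed

end
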